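(* Let $\gamma\ge2$, let $f(x)\in k[x]$ be monic, separable, of degree $2\gamma+1$ with $f(0)\ne0$, let $B$ be the hyperelliptic curve $y^2=f(x)$ with point at infinity $q$, fix a square root $\sqrt{f(0)}$, put $p=(0,\sqrt{f(0)})$, and let $\sum_{i\ge0}a_ix^i\in k[[x]]$ be the square root of $f$ with $a_0=\sqrt{f(0)}$. Let $(\epsilon_j)_{j\ge1}$ be the multiplication profile of $[p-q]$. Fix $n\ge\gamma+2$. When $n+\gamma$ is odd (resp. even), we have $\epsilon_n<\gamma$ if and only if $D_n=0$, where $$D_n:=\begin{vmatrix} a_{\gamma+2} & a_{\gamma+3} & \cdots & a_{\frac{n+\gamma+1}2} \\ a_{\gamma+3} & a_{\gamma+4} & \cdots & a_{\frac{n+\gamma+3}2} \\ \vdots & \vdots & & \vdots \\ a_{\frac{n+\gamma+1}2} & a_{\frac{n+\gamma+3}2} & \cdots & a_{n-1} \end{vmatrix}\qquad\left(\text{resp. }D_n:=\begin{vmatrix} a_{\gamma+1} & a_{\gamma+2} & \cdots & a_{\frac{n+\gamma}2} \\ a_{\gamma+2} & a_{\gamma+3} & \cdots & a_{\frac{n+\gamma+2}2} \\ \vdots & \vdots & & \vdots \\ a_{\frac{n+\gamma}2} & a_{\frac{n+\gamma+2}2} & \cdots & a_{n-1} \end{vmatrix}\right).$$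
   Context: $k$ is an algebraically closed field of characteristic zero. For $d\ge0$ let $\Theta_d\subset\operatorname{Jac}(B)$ be the image of $B^d\to\operatorname{Jac}(B)$, $(p_1,\dots,p_d)\mapsto[\sum p_i-dq]$, and $\Theta_d^0=\Theta_d\setminus\Theta_{d-1}$ (with $\Theta_{-1}=\emptyset$). The multiplication profile of $x\in\operatorname{Jac}(B)$ is the sequence $(\epsilon_j)_{j\ge1}$ where $\epsilon_j$ is the unique integer, $0\le\epsilon_j\le\gamma$, with $jx\in\Theta^0_{\epsilon_j}$. The displayed matrices are Hankel matrices, of size $\frac{n-\gamma-1}2$ (resp. $\frac{n-\gamma}2$). *)

theory Defs
  imports
    "HOL-Computational_Algebra.Computational_Algebra"
    "HOL-Algebra.Algebraic_Closure_Type"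
    "HOL-Algebra.Free_Abelian_Groups"
    "Jordan_Normal_Form.Determinant"
begin

definition genus :: "'a::field poly \<Rightarrow> nat" where
  "genus f = (degree f - 1) div 2"

datatype 'a point = Affine 'a 'a | Infinity

definition curve :: "'a::field poly \<Rightarrow> 'a point set" where
  "curve f = insert Infinity {Affine a b | a b. b ^ 2 = poly f a}"

text \<open>The function field \<open>k(x, y)\<close> with \<open>y\<^sup>2 = f(x)\<close> is realised as a subfield of an algebraic
  closure of \<open>k(x)\<close>. The two choices of \<open>y\<close> give the same subfield and differ by an automorphism
  of it over \<open>k(x)\<close>; no relation between \<open>y\<close> and a chosen value of a square root at a point is
  assumed.\<close>

definition const :: "'a::field \<Rightarrow> 'a poly fract alg_closure" where
  "const c = to_ac (Fract [:c:] 1)"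

definition x_fn :: "'a::field poly fract alg_closure" where
  "x_fn = to_ac (Fract [:0, 1:] 1)"

definition y_fn :: "'a::field poly \<Rightarrow> 'a poly fract alg_closure" where
  "y_fn f = (SOME y. y ^ 2 = to_ac (Fract f 1))"

text \<open>Value at \<open>(u, v)\<close> of a polynomial in two variables, represented as a polynomial in the second
  variable over the polynomials in the first, with coefficients transported along \<open>h\<close>.\<close>

definition eval2 :: "('a::field \<Rightarrow> 'b::field) \<Rightarrow> 'a poly poly \<Rightarrow> 'b \<times> 'b \<Rightarrow> 'b" where
  "eval2 h F = (\<lambda>(u, v). poly (map_poly (\<lambda>g. poly (map_poly h g) u) F) v)"

definition function_field :: "'a::field poly \<Rightarrow> 'a poly fract alg_closure set" where
  "function_field f =
     {eval2 const F (x_fn, y_fn f) / eval2 const G (x_fn, y_fn f) | F G.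
        eval2 const G (x_fn, y_fn f) \<noteq> 0}"

text \<open>The curve is glued from two smooth affine plane curves: \<open>y\<^sup>2 = f(x)\<close>, and, with
  \<open>u = 1/x\<close> and \<open>v = y/x\<^bsup>g+1\<^esup>\<close>, the curve \<open>v\<^sup>2 = u\<^bsup>2g+2\<^esup> f(1/u)\<close>, whose point \<open>(0, 0)\<close> is the point
  at infinity. For each point we fix the coordinate functions of a chart containing it
  and the coordinates of the point in that chart.\<close>

fun chart :: "'a::field poly \<Rightarrow> 'a point \<Rightarrow>
    'a poly fract alg_closure \<times> 'a poly fract alg_closure" where
  "chart f (Affine a b) = (x_fn, y_fn f)"
| "chart f Infinity = (1 / x_fn, y_fn f / x_fn ^ (genus f + 1))"

fun coords :: "'a::field point \<Rightarrow> 'a \<times> 'a" where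
  "coords (Affine a b) = (a, b)"
| "coords Infinity = (0, 0)"

definition local_ring :: "'a::field poly \<Rightarrow> 'a point \<Rightarrow> 'a poly fract alg_closure set" where
  "local_ring f P =
     {eval2 const F (chart f P) / eval2 const G (chart f P) | F G.
        eval2 id G (coords P) \<noteq> 0}"

definition local_units :: "'a::field poly \<Rightarrow> 'a point \<Rightarrow> 'a poly fract alg_closure set" where
  "local_units f P = {\<phi> \<in> local_ring f P. \<phi> \<noteq> 0 \<and> inverse \<phi> \<in> local_ring f P}"

definition max_ideal :: "'a::field poly \<Rightarrow> 'a point \<Rightarrow> 'a poly fract alg_closure set" where
  "max_ideal f P = local_ring f P - local_units f P"

definition uniformizer :: "'a::field poly \<Rightarrow> 'a point \<Rightarrow> 'a poly fract alg_closure \<Rightarrow> bool" where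
  "uniformizer f P t \<longleftrightarrow> max_ideal f P = (\<lambda>\<phi>. t * \<phi>) ` local_ring f P"

definition ord_at :: "'a::field poly \<Rightarrow> 'a point \<Rightarrow> 'a poly fract alg_closure \<Rightarrow> int" where
  "ord_at f P \<phi> =
     (THE m. \<exists>t w. uniformizer f P t \<and> w \<in> local_units f P \<and> \<phi> = w * t powi m)"

text \<open>The points of the Jacobian over the algebraically closed base field are the divisor
  classes of degree zero.\<close>

definition div_degree :: "('p \<Rightarrow>\<^sub>0 int) \<Rightarrow> int" where
  "div_degree D = (\<Sum>P\<in>Poly_Mapping.keys D. Poly_Mapping.lookup D P)"

definition div0_group :: "'a::field poly \<Rightarrow> ('a point \<Rightarrow>\<^sub>0 int) monoid" where
  "div0_group f = (free_Abelian_group (curve f))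
     \<lparr>carrier := {D \<in> carrier (free_Abelian_group (curve f)). div_degree D = 0}\<rparr>"

definition principal_divisors :: "'a::field poly \<Rightarrow> ('a point \<Rightarrow>\<^sub>0 int) set" where
  "principal_divisors f =
     {D \<in> carrier (free_Abelian_group (curve f)).
        \<exists>\<phi>\<in>function_field f - {0}. \<forall>P\<in>curve f. Poly_Mapping.lookup D P = ord_at f P \<phi>}"

definition Jac :: "'a::field poly \<Rightarrow> ('a point \<Rightarrow>\<^sub>0 int) set monoid" where
  "Jac f = div0_group f Mod principal_divisors f"

definition div_class :: "'a::field poly \<Rightarrow> ('a point \<Rightarrow>\<^sub>0 int) \<Rightarrow> ('a point \<Rightarrow>\<^sub>0 int) set" where
  "div_class f D = principal_divisors f #>\<^bsub>div0_group f\<^esub> D"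

definition Theta :: "'a::field poly \<Rightarrow> nat \<Rightarrow> ('a point \<Rightarrow>\<^sub>0 int) set set" where
  "Theta f d = {div_class f (sum_list (map frag_of ps) - frag_cmul (int d) (frag_of Infinity)) | ps.
     length ps = d \<and> set ps \<subseteq> curve f}"

fun Theta0 :: "'a::field poly \<Rightarrow> nat \<Rightarrow> ('a point \<Rightarrow>\<^sub>0 int) set set" where
  "Theta0 f 0 = Theta f 0"
| "Theta0 f (Suc d) = Theta f (Suc d) - Theta f d"

definition mult_profile :: "'a::field poly \<Rightarrow> ('a point \<Rightarrow>\<^sub>0 int) set \<Rightarrow> nat \<Rightarrow> nat" where
  "mult_profile f \<xi> j = (THE e. e \<le> genus f \<and> \<xi> [^]\<^bsub>Jac f\<^esub> j \<in> Theta0 f e)"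

definition hankel :: "(nat \<Rightarrow> 'a) \<Rightarrow> nat \<Rightarrow> nat \<Rightarrow> 'a mat" where
  "hankel a r m = mat m m (\<lambda>(i, j). a (r + i + j))"

end

theory Submission
  imports Defs
begin

text \<open>
  Write \<open>q\<close> for the point at infinity, \<open>p = (0, s)\<close> and \<open>p' = (0, -s)\<close>. The strata \<open>\<Theta>\<^sup>0\<^sub>d\<close> are the
  successive differences of an increasing chain, so \<open>\<epsilon>\<^sub>n < \<gamma>\<close> means that \<open>n(p - q)\<close> lies in
  \<open>\<Theta>\<^bsub>\<gamma>-1\<^esub>\<close>, provided that \<open>n(p - q)\<close> lies in \<open>\<Theta>\<^sub>\<gamma>\<close> at all (\<open>mult_profile_less_iff\<close>).

  Since \<open>x\<close> has divisor \<open>p + p' - 2q\<close>, the class \<open>n(p - q)\<close> lies in \<open>\<Theta>\<^sub>d\<close> iff there is a function whose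
  only pole is at \<open>q\<close>, of order at most \<open>n + d\<close>, and which vanishes to order \<open>n\<close> at \<open>p'\<close>
  (\<open>multiple_in_Theta_iff\<close>). Functions with no other pole than \<open>q\<close> have the form \<open>U + V y\<close> with polynomials
  \<open>U, V\<close> in \<open>x\<close> (\<open>regular_imp_fn\<close>), and the pole has order \<open>max (2 deg U) (2 deg V + 2\<gamma> + 1)\<close>
  (\<open>fn_ord_infinity\<close>). At \<open>p'\<close> the function \<open>y\<close> expands as \<open>-A\<close>, so the vanishing condition is
  \<open>U \<equiv> V A\<close> modulo \<open>x\<^sup>n\<close> (\<open>ord_ge_iff_series\<close>). Eliminating \<open>U\<close>, one is left with a homogeneous linear
  system for the coefficients of \<open>V\<close>, which says that a block of coefficients of \<open>V A\<close> vanishes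
  (\<open>multiple_in_Theta_iff_gap\<close>). For \<open>d = \<gamma>\<close> it has one more unknown than equations and is solvable; for
  \<open>d = \<gamma> - 1\<close> it is square, and its matrix is the Hankel matrix of the theorem up to the order of the
  unknowns.

  The geometric input is elementary. Near each point the curve is a double cover \<open>v\<^sup>2 = h(u)\<close> of a line,
  with \<open>u = x\<close>, or \<open>u = 1/x\<close> at infinity. Its local ring is a discrete valuation ring, because one function
  generates the ideal of the functions vanishing at the point (\<open>param_dvd_elem\<close>), and the order of
  \<open>U + V v\<close> is governed by the norm \<open>U\<^sup>2 - V\<^sup>2 h\<close>: over each \<open>a\<close> the orders of \<open>U + V v\<close> add up to the
  order of the norm at \<open>a\<close>. Summing over all \<open>a\<close> shows that \<open>U + V y\<close> has as many zeros as the order of its pole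
  (\<open>zero_multiset\<close>).
\<close>

section \<open>Discrete valuation rings inside a field\<close>


definition ring_units :: "'k::field set \<Rightarrow> 'k set" where
  "ring_units R = {\<phi> \<in> R. \<phi> \<noteq> 0 \<and> inverse \<phi> \<in> R}"

locale valuation_subring =
  fixes R :: "'k::field set" and t :: 'k
  assumes one_mem: "1 \<in> R"
    and add_mem: "\<And>x y. x \<in> R \<Longrightarrow> y \<in> R \<Longrightarrow> x + y \<in> R"
    and mult_mem: "\<And>x y. x \<in> R \<Longrightarrow> y \<in> R \<Longrightarrow> x * y \<in> R"
    and uminus_mem: "\<And>x. x \<in> R \<Longrightarrow> - x \<in> R"
    and nonunits: "R - ring_units R = (\<lambda>x. t * x) ` R"
    and param_nonzero: "t \<noteq> 0"
begin

text \<open>The order is a relation: no integer is related to \<open>0\<close> or to an element outside the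
  fraction field of \<open>R\<close>.\<close>

definition has_ord :: "'k \<Rightarrow> int \<Rightarrow> bool" where
  "has_ord \<phi> m \<longleftrightarrow> (\<exists>w\<in>ring_units R. \<phi> = w * t powi m)"

lemma unit_mult: "w \<in> ring_units R \<Longrightarrow> w' \<in> ring_units R \<Longrightarrow> w * w' \<in> ring_units R"
  by (auto simp: ring_units_def mult_mem)

lemma unit_inverse: "w \<in> ring_units R \<Longrightarrow> inverse w \<in> ring_units R"
  by (auto simp: ring_units_def)

lemma unit_one: "1 \<in> ring_units R"
  by (auto simp: ring_units_def one_mem)

lemma unit_power: "w \<in> ring_units R \<Longrightarrow> w ^ n \<in> ring_units R"
  by (induction n) (auto simp: unit_one unit_mult)

lemma unit_power_int: "w \<in> ring_units R \<Longrightarrow> w powi m \<in> ring_units R"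
  by (cases m) (auto simp: unit_power unit_inverse power_int_def)

lemma param_mult_nonunit: "x \<in> R \<Longrightarrow> t * x \<in> R \<and> t * x \<notin> ring_units R"
  using nonunits by blast

lemma param_mem: "t \<in> R" "t \<notin> ring_units R"
  using param_mult_nonunit[OF one_mem] by auto

lemma nonunitE:
  assumes "x \<in> R" "x \<notin> ring_units R"
  obtains y where "y \<in> R" "x = t * y"
  using assms nonunits by blast

lemma has_ord_nonzero: "has_ord \<phi> m \<Longrightarrow> \<phi> \<noteq> 0"
  by (auto simp: has_ord_def ring_units_def param_nonzero)

lemma has_ord_mult: "has_ord \<phi> m \<Longrightarrow> has_ord \<psi> l \<Longrightarrow> has_ord (\<phi> * \<psi>) (m + l)"
  unfolding has_ord_def
  by (auto simp: power_int_add param_nonzero intro!: bexI[OF _ unit_mult])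

lemma has_ord_inverse: "has_ord \<phi> m \<Longrightarrow> has_ord (inverse \<phi>) (- m)"
  unfolding has_ord_def
  by (auto simp: power_int_minus intro!: bexI[OF _ unit_inverse])

lemma has_ord_divide: "has_ord \<phi> m \<Longrightarrow> has_ord \<psi> l \<Longrightarrow> has_ord (\<phi> / \<psi>) (m - l)"
  using has_ord_mult[OF _ has_ord_inverse, of \<phi> m \<psi> l] by (simp add: divide_inverse)

lemma has_ord_unit: "w \<in> ring_units R \<Longrightarrow> has_ord w 0"
  by (auto simp: has_ord_def)

lemma has_ord_param: "has_ord t 1"
  by (auto simp: has_ord_def intro!: bexI[OF _ unit_one])

lemma has_ord_power: "has_ord \<phi> m \<Longrightarrow> has_ord (\<phi> ^ n) (int n * m)"
proof (induction n)
  case (Suc n)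
  then show ?case
    using has_ord_mult[of \<phi> m "\<phi> ^ n" "int n * m"] by (simp add: algebra_simps)
qed (auto intro: has_ord_unit unit_one)

lemma has_ord_nonneg_imp_mem:
  assumes "has_ord \<phi> m" "m \<ge> 0"
  shows "\<phi> \<in> R"
proof -
  have pow: "t ^ k \<in> R" for k
    by (induction k) (auto simp: one_mem mult_mem param_mem)
  obtain w where w: "w \<in> ring_units R" "\<phi> = w * t powi m"
    using assms by (auto simp: has_ord_def)
  have "t powi m = t ^ nat m"
    using assms by (simp add: power_int_def)
  then show ?thesis
    using w pow by (auto simp: ring_units_def mult_mem)
qed

lemma has_ord_pos_imp_nonunit:
  assumes "has_ord \<phi> m" "m > 0"
  obtains y where "y \<in> R" "\<phi> = t * y"
proof -
  have "has_ord (\<phi> / t) (m - 1)"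
    by (intro has_ord_divide has_ord_param assms)
  then have "\<phi> / t \<in> R"
    using assms by (intro has_ord_nonneg_imp_mem[of _ "m - 1"]) auto
  then show ?thesis
    using that[of "\<phi> / t"] param_nonzero by simp
qed

lemma mem_imp_has_ord_nonneg:
  assumes "has_ord \<phi> m" "\<phi> \<in> R"
  shows "m \<ge> 0"
proof (rule ccontr)
  assume "\<not> m \<ge> 0"
  then have "has_ord (inverse \<phi>) (- m)" "- m > 0"
    using has_ord_inverse[OF assms(1)] by auto
  then obtain y where y: "y \<in> R" "inverse \<phi> = t * y"
    by (rule has_ord_pos_imp_nonunit)
  have "\<phi> \<noteq> 0"
    using assms has_ord_nonzero by blast
  then have "t * (y * \<phi>) = 1"
    using y by (metis left_inverse mult.assoc)
  then show False
    using param_mult_nonunit[OF mult_mem[OF y(1) assms(2)]] unit_one by simp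
qed

lemma has_ord_unique:
  assumes "has_ord \<phi> m" "has_ord \<phi> l"
  shows "m = l"
proof -
  have "\<phi> \<noteq> 0"
    using assms has_ord_nonzero by blast
  then have "has_ord 1 (m - l)" "has_ord 1 (l - m)"
    using has_ord_divide[OF assms] has_ord_divide[OF assms(2,1)] by simp_all
  then have "m - l \<ge> 0" "l - m \<ge> 0"
    using mem_imp_has_ord_nonneg one_mem by blast+
  then show ?thesis by simp
qed

text \<open>A unit plus a non-unit is a unit, because the non-units form an ideal; hence the ultrametric
  inequality is an equality when the two orders differ.\<close>

lemma has_ord_add:
  assumes "has_ord \<phi> m" "has_ord \<psi> l" "m < l"
  shows "has_ord (\<phi> + \<psi>) m"
proof -
  obtain w where w: "w \<in> ring_units R" "\<phi> = w * t powi m"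
    using assms by (auto simp: has_ord_def)
  have "has_ord (\<psi> / t powi m) (l - m)"
  proof -
    have "has_ord (t powi m) m"
      by (auto simp: has_ord_def intro!: bexI[OF _ unit_one])
    then show ?thesis
      by (rule has_ord_divide[OF assms(2)])
  qed
  moreover have "l - m > 0"
    using assms(3) by simp
  ultimately obtain z where z: "z \<in> R" "\<psi> / t powi m = t * z"
    by (rule has_ord_pos_imp_nonunit)
  have "w + t * z \<in> ring_units R"
  proof (rule ccontr)
    assume *: "w + t * z \<notin> ring_units R"
    moreover have "w + t * z \<in> R"
      using w z param_mult_nonunit by (auto simp: ring_units_def intro: add_mem)
    ultimately obtain y where y: "y \<in> R" "w + t * z = t * y"
      using nonunitE by blast
    then have "w = t * (y + - z)"
      by (simp add: algebra_simps)
    moreover have "y + - z \<in> R"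
      by (intro add_mem uminus_mem y z)
    ultimately show False
      using w(1) param_mult_nonunit by metis
  qed
  moreover have "\<phi> + \<psi> = (w + t * z) * t powi m"
  proof -
    have "\<psi> = t * z * t powi m"
      using z(2) param_nonzero by (simp add: field_simps)
    then show ?thesis
      using w(2) by (simp add: algebra_simps)
  qed
  ultimately show ?thesis
    by (auto simp: has_ord_def)
qed

text \<open>Any two uniformizers differ by a unit, so the order does not depend on the one chosen.\<close>

lemma order_independent_of_uniformizer:
  assumes "has_ord \<phi> m"
  shows "(THE m. \<exists>t' w. R - ring_units R = (\<lambda>x. t' * x) ` R \<and> w \<in> ring_units R \<and> \<phi> = w * t' powi m) = m"
proof (rule the_equality)
  show "\<exists>t' w. R - ring_units R = (\<lambda>x. t' * x) ` R \<and> w \<in> ring_units R \<and> \<phi> = w * t' powi m"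
    using assms nonunits by (auto simp: has_ord_def)
next
  fix l
  assume "\<exists>t' w. R - ring_units R = (\<lambda>x. t' * x) ` R \<and> w \<in> ring_units R \<and> \<phi> = w * t' powi l"
  then obtain t' w where t': "R - ring_units R = (\<lambda>x. t' * x) ` R"
    and w: "w \<in> ring_units R" "\<phi> = w * t' powi l"
    by blast
  have "t' \<in> R - ring_units R" "t \<in> R - ring_units R"
    using t' nonunits one_mem by (metis image_eqI mult.right_neutral)+
  then obtain c d where cd: "c \<in> R" "t' = t * c" "d \<in> R" "t = t' * d"
    using t' nonunits by (metis imageE)
  then have "c * d = 1"
  proof -
    have "t * (c * d) = t * 1"
      using cd(2,4) by (metis mult.assoc mult.right_neutral)
    then show ?thesis
      using param_nonzero mult_left_cancel by blast
  qed
  moreover from this have "inverse c = d"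
    by (rule inverse_unique)
  ultimately have "c \<in> ring_units R"
    using cd by (auto simp: ring_units_def)
  moreover from this have "\<phi> = (w * c powi l) * t powi l"
    using w(2) cd(2) by (simp add: power_int_mult_distrib)
  ultimately have "has_ord \<phi> l"
    unfolding has_ord_def using unit_mult[OF w(1) unit_power_int] by blast
  then show "l = m"
    using assms has_ord_unique by blast
qed

end

section \<open>Local rings of a double cover of the line\<close>


text \<open>This splitting separates the zeros that \<open>U + V v\<close> has because of a common factor, which are the
  same at all points over \<open>a\<close>, from those special to one point.\<close>

lemma common_linear_power:
  fixes U V :: "'a::idom poly"
  assumes "U \<noteq> 0 \<or> V \<noteq> 0"
  obtains k U' V' where "U = [:-a, 1:] ^ k * U'" "V = [:-a, 1:] ^ k * V'"
    "poly U' a \<noteq> 0 \<or> poly V' a \<noteq> 0"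
proof -
  have *: "\<exists>k U' V'. U = [:-a, 1:] ^ k * U' \<and> V = [:-a, 1:] ^ k * V' \<and>
      (poly U' a \<noteq> 0 \<or> poly V' a \<noteq> 0)"
    if U: "U \<noteq> 0" and V: "V = 0 \<or> Polynomial.order a U \<le> Polynomial.order a V" for U V :: "'a poly"
  proof -
    obtain U' where U': "U = [:-a, 1:] ^ Polynomial.order a U * U'" "\<not> [:-a, 1:] dvd U'"
      using order_decomp[OF U, of a] by blast
    have "[:-a, 1:] ^ Polynomial.order a U dvd V"
      using V by (auto simp: order_divides)
    then obtain V' where "V = [:-a, 1:] ^ Polynomial.order a U * V'"
      by (elim dvdE)
    then show ?thesis
      using U' by (auto simp: poly_eq_0_iff_dvd)
  qed
  have "(U \<noteq> 0 \<and> (V = 0 \<or> Polynomial.order a U \<le> Polynomial.order a V)) \<or>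
    (V \<noteq> 0 \<and> (U = 0 \<or> Polynomial.order a V \<le> Polynomial.order a U))"
    using assms by auto
  then show ?thesis
  proof
    assume "U \<noteq> 0 \<and> (V = 0 \<or> Polynomial.order a U \<le> Polynomial.order a V)"
    then show ?thesis using *[of U V] that by blast
  next
    assume "V \<noteq> 0 \<and> (U = 0 \<or> Polynomial.order a V \<le> Polynomial.order a U)"
    then show ?thesis using *[of V U] that by blast
  qed
qed

lemma order_linear_power_mult:
  fixes q :: "'a::idom poly"
  assumes "poly q a \<noteq> 0"
  shows "Polynomial.order a ([:-a, 1:] ^ k * q) = k"
proof -
  have "q \<noteq> 0" using assms by auto
  moreover have "[:-a, 1:] ^ k \<noteq> 0" by simp
  ultimately show ?thesis
    using assms by (simp add: order_mult order_power_n_n order_0I del: power_eq_0_iff)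
qed

text \<open>The two sides have orders of different parity at \<open>r\<close>. Hence \<open>h\<close> is not a square in the field
  of rational functions.\<close>

lemma square_eq_square_mult_odd_order:
  fixes U V h :: "'a::idom poly"
  assumes "U ^ 2 = V ^ 2 * h" and h: "h \<noteq> 0" "odd (Polynomial.order r h)"
  shows "U = 0 \<and> V = 0"
proof (rule ccontr)
  assume neg: "\<not> (U = 0 \<and> V = 0)"
  have "U \<noteq> 0" "V \<noteq> 0"
    using neg assms(1) h(1) by auto
  then have "2 * Polynomial.order r U = 2 * Polynomial.order r V + Polynomial.order r h"
    using arg_cong[OF assms(1), of "Polynomial.order r"] h
    by (simp add: power2_eq_square order_mult)
  then show False
    using h(2) by presburger
qed

text \<open>A double cover \<open>v\<^sup>2 = h(u)\<close> of the line together with a smooth point \<open>(a, b)\<close> on it. The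
  homomorphism \<open>E\<close> substitutes the coordinate \<open>u\<close>, an element of the field \<open>'k\<close>, in a polynomial.
  A root of odd multiplicity of \<open>h\<close> makes \<open>v\<close> irrational over \<open>u\<close>.\<close>

locale double_cover_point =
  fixes E :: "'a::field_char_0 poly \<Rightarrow> 'k::field"
    and v :: 'k
    and h :: "'a poly"
    and a b :: 'a
  assumes E_add: "E (p + q) = E p + E q"
    and E_mult: "E (p * q) = E p * E q"
    and E_one: "E 1 = 1"
    and E_inj: "E p = 0 \<Longrightarrow> p = 0"
    and v_square: "v ^ 2 = E h"
    and point_on_cover: "b ^ 2 = poly h a"
    and smooth: "b = 0 \<Longrightarrow> Polynomial.order a h = 1"
    and h_nonzero: "h \<noteq> 0"
    and irrational: "\<exists>r. odd (Polynomial.order r h)"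
begin

lemma E_zero: "E 0 = 0"
  using E_add[of 0 0] by (metis add.right_neutral add_left_cancel)

lemma E_uminus: "E (- p) = - E p"
  using E_add[of p "- p"] E_zero by (simp add: add_eq_0_iff)

lemma E_diff: "E (p - q) = E p - E q"
  using E_add[of p "- q"] E_uminus by simp

lemma E_power: "E (p ^ n) = E p ^ n"
  by (induction n) (auto simp: E_one E_mult)

lemma E_eq_zero_iff: "E p = 0 \<longleftrightarrow> p = 0"
  using E_inj E_zero by auto

text \<open>The coordinate ring of the cover is free over the polynomials in \<open>u\<close> with basis \<open>1, v\<close>; the pair
  \<open>(U, V)\<close> stands for its element \<open>U + V v\<close>, and \<open>val\<close> is the value of that element at \<open>(a, b)\<close>.\<close>

definition elem :: "'a poly \<Rightarrow> 'a poly \<Rightarrow> 'k" where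
  "elem U V = E U + E V * v"

definition val :: "'a poly \<Rightarrow> 'a poly \<Rightarrow> 'a" where
  "val U V = poly U a + poly V a * b"

lemma elem_mult: "elem U V * elem U' V' = elem (U * U' + V * V' * h) (U * V' + V * U')"
proof -
  have "elem U V * elem U' V' = E U * E U' + E V * E V' * v ^ 2 + (E U * E V' + E V * E U') * v"
    by (simp add: elem_def power2_eq_square algebra_simps)
  then show ?thesis
    by (simp add: v_square elem_def E_add E_mult)
qed

lemma val_mult: "val U V * val U' V' = val (U * U' + V * V' * h) (U * V' + V * U')"
proof -
  have "val U V * val U' V' =
     poly U a * poly U' a + poly V a * poly V' a * b ^ 2 + (poly U a * poly V' a + poly V a * poly U' a) * b"
    by (simp add: val_def power2_eq_square algebra_simps)
  then show ?thesis
    by (simp add: point_on_cover val_def)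
qed

lemma elem_add: "elem U V + elem U' V' = elem (U + U') (V + V')"
  by (simp add: elem_def E_add algebra_simps)

lemma val_add: "val U V + val U' V' = val (U + U') (V + V')"
  by (simp add: val_def algebra_simps)

lemma elem_zero: "elem 0 0 = 0"
  and elem_poly: "elem U 0 = E U"
  and elem_v: "elem 0 1 = v"
  and elem_one: "elem 1 0 = 1"
  and val_poly: "val U 0 = poly U a"
  and val_v: "val 0 1 = b"
  and val_one: "val 1 0 = 1"
  by (simp_all add: elem_def val_def E_zero E_one)

lemma elem_norm: "elem U V * elem U (- V) = E (U ^ 2 - V ^ 2 * h)"
  using elem_poly[of "U ^ 2 - V ^ 2 * h"] by (simp add: elem_mult power2_eq_square)

lemma elem_eq_zero: "elem U V = 0 \<longleftrightarrow> U = 0 \<and> V = 0"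
proof
  assume "elem U V = 0"
  then have "E (U ^ 2 - V ^ 2 * h) = 0"
    using elem_norm[of U V] by simp
  then have "U ^ 2 = V ^ 2 * h"
    by (simp add: E_eq_zero_iff)
  then show "U = 0 \<and> V = 0"
    using irrational h_nonzero square_eq_square_mult_odd_order by blast
qed (simp add: elem_zero)

lemma elem_eq_iff: "elem U V = elem U' V' \<longleftrightarrow> U = U' \<and> V = V'"
proof -
  have "elem U V = elem U' V' \<longleftrightarrow> elem (U - U') (V - V') = 0"
    by (auto simp: elem_def E_diff algebra_simps)
  then show ?thesis by (simp add: elem_eq_zero)
qed

lemma val_nonzero_imp_elem_nonzero: "val U V \<noteq> 0 \<Longrightarrow> elem U V \<noteq> 0"
  by (auto simp: elem_eq_zero val_def)

definition germs :: "'k set" where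
  "germs = {elem U V / elem U' V' | U V U' V'. val U' V' \<noteq> 0}"

definition param :: 'k where
  "param = (if b = 0 then v else E [:-a, 1:])"

lemma param_ramified: "b = 0 \<Longrightarrow> param = v"
  and param_unramified: "b \<noteq> 0 \<Longrightarrow> param = E [:-a, 1:]"
  unfolding param_def by simp_all

lemma elem_in_germs: "elem U V \<in> germs"
  unfolding germs_def by (rule CollectI, intro exI[of _ U] exI[of _ V] exI[of _ 1] exI[of _ 0])
    (simp add: val_one elem_one)

lemma germs_mult:
  assumes "x \<in> germs" "y \<in> germs"
  shows "x * y \<in> germs"
proof -
  obtain A B C D where x: "x = elem A B / elem C D" "val C D \<noteq> 0"
    using assms by (auto simp: germs_def)
  obtain A' B' C' D' where y: "y = elem A' B' / elem C' D'" "val C' D' \<noteq> 0"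
    using assms by (auto simp: germs_def)
  have "x * y = elem A B * elem A' B' / (elem C D * elem C' D')"
    by (simp add: x y)
  moreover have "val C D * val C' D' \<noteq> 0"
    using x y by simp
  ultimately show ?thesis
    unfolding germs_def elem_mult val_mult by blast
qed

lemma germs_add:
  assumes "x \<in> germs" "y \<in> germs"
  shows "x + y \<in> germs"
proof -
  obtain A B C D where x: "x = elem A B / elem C D" "val C D \<noteq> 0"
    using assms by (auto simp: germs_def)
  obtain A' B' C' D' where y: "y = elem A' B' / elem C' D'" "val C' D' \<noteq> 0"
    using assms by (auto simp: germs_def)
  have "x + y = (elem A B * elem C' D' + elem A' B' * elem C D) / (elem C D * elem C' D')"
    using x y by (simp add: val_nonzero_imp_elem_nonzero add_frac_eq)
  moreover have "val C D * val C' D' \<noteq> 0"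
    using x y by simp
  ultimately show ?thesis
    unfolding germs_def elem_mult val_mult elem_add by blast
qed

lemma inverse_elem_in_germs: "val U V \<noteq> 0 \<Longrightarrow> inverse (elem U V) \<in> germs"
  unfolding germs_def by (rule CollectI, intro exI[of _ 1] exI[of _ 0] exI[of _ U] exI[of _ V])
    (simp add: elem_one inverse_eq_divide)

lemma germs_uminus: "x \<in> germs \<Longrightarrow> - x \<in> germs"
  using germs_mult[of "elem (-1) 0" x] elem_in_germs[of "-1" 0] by (simp add: elem_poly E_uminus E_one)

text \<open>If the inverse of \<open>U + V v\<close> is regular at the point, clearing denominators gives an identity between
  elements of the coordinate ring, which can be evaluated at the point because representations by
  pairs are unique.\<close>

lemma elem_unit_iff: "elem U V \<in> ring_units germs \<longleftrightarrow> val U V \<noteq> 0"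
proof
  assume "val U V \<noteq> 0"
  then show "elem U V \<in> ring_units germs"
    by (auto simp: ring_units_def elem_in_germs inverse_elem_in_germs val_nonzero_imp_elem_nonzero)
next
  assume u: "elem U V \<in> ring_units germs"
  then obtain A B C D where x: "inverse (elem U V) = elem A B / elem C D" "val C D \<noteq> 0"
    by (auto simp: ring_units_def germs_def)
  have "elem U V \<noteq> 0"
    using u by (auto simp: ring_units_def)
  then have "elem U V * elem A B = elem C D"
    using x val_nonzero_imp_elem_nonzero[OF x(2)]
    by (metis (no_types, lifting) divide_inverse inverse_inverse_eq mult.commute nonzero_divide_eq_eq inverse_nonzero_iff_nonzero)
  then have "val U V * val A B = val C D"
    by (simp add: elem_mult val_mult elem_eq_iff)
  then show "val U V \<noteq> 0"
    using x(2) by auto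
qed

lemma poly_unit_iff: "E W \<in> ring_units germs \<longleftrightarrow> poly W a \<noteq> 0"
  using elem_unit_iff[of W 0] by (simp add: elem_poly val_poly)

lemma E_in_germs: "E W \<in> germs"
  using elem_in_germs[of W 0] by (simp add: elem_poly)

lemma v_in_germs: "v \<in> germs"
  using elem_in_germs[of 0 1] by (simp add: elem_v)

text \<open>At a branch point \<open>u - a\<close> is a unit times \<open>v\<^sup>2\<close>, since \<open>a\<close> is a simple root of \<open>h\<close>.\<close>

lemma linear_ramified:
  assumes "b = 0"
  obtains g where "poly g a \<noteq> 0" "h = [:-a, 1:] * g" "E [:-a, 1:] = v ^ 2 * inverse (E g)"
    "inverse (E g) \<in> ring_units germs"
proof -
  obtain g where g: "h = [:-a, 1:] ^ 1 * g" "\<not> [:-a, 1:] dvd g"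
    using order_decomp[OF h_nonzero, of a] smooth[OF assms] by auto
  have ga: "poly g a \<noteq> 0"
    using g by (simp add: poly_eq_0_iff_dvd)
  then have u: "inverse (E g) \<in> ring_units germs"
    using poly_unit_iff[of g] by (auto simp: ring_units_def)
  have "v ^ 2 = E [:-a, 1:] * E g"
    using v_square g by (simp add: E_mult[symmetric])
  moreover have "E g \<noteq> 0"
    using ga E_inj by fastforce
  ultimately show ?thesis
    using that[OF ga _ _ u] g(1) by (simp add: field_simps)
qed

text \<open>Away from the branch points \<open>(v - b) (v + b) = h(u) - b\<^sup>2\<close> is divisible by \<open>u - a\<close> while \<open>v + b\<close> takes
  the non-zero value \<open>2 b\<close>, so \<open>u - a\<close> divides \<open>v - b\<close> locally. At a branch point \<open>v\<close> divides \<open>u - a\<close>.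
  In both cases one function generates the ideal of functions vanishing at the point.\<close>

lemma param_dvd_elem:
  assumes "val U V = 0"
  obtains y where "y \<in> germs" "elem U V = param * y"
proof (cases "b = 0")
  case False
  define W where "W = (U + smult b V) div [:-a, 1:]"
  define Q where "Q = (h - [:b ^ 2:]) div [:-a, 1:]"
  have W: "U + smult b V = [:-a, 1:] * W"
    using assms unfolding W_def val_def
    by (subst dvd_mult_div_cancel) (auto simp: poly_eq_0_iff_dvd[symmetric] algebra_simps)
  have Q: "h - [:b ^ 2:] = [:-a, 1:] * Q"
    unfolding Q_def
    by (subst dvd_mult_div_cancel) (auto simp: poly_eq_0_iff_dvd[symmetric] point_on_cover)
  have val': "val [:b:] 1 \<noteq> 0"
    using False by (simp add: val_def)
  have "elem [:b:] 1 \<noteq> 0"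
    using val' by (rule val_nonzero_imp_elem_nonzero)
  have "elem [:-b:] 1 * elem [:b:] 1 = E (h - [:b ^ 2:])"
    unfolding elem_mult elem_poly[symmetric] elem_eq_iff
    by (auto simp: power2_eq_square)
  then have *: "elem [:-b:] 1 = E (h - [:b ^ 2:]) * inverse (elem [:b:] 1)"
    using \<open>elem [:b:] 1 \<noteq> 0\<close> by (simp add: field_simps)
  have "elem U V = E (U + smult b V) + E V * elem [:-b:] 1"
    unfolding elem_poly[symmetric] elem_mult elem_add elem_eq_iff by simp
  also have "\<dots> = param * (E W + E V * E Q * inverse (elem [:b:] 1))"
    unfolding * W Q E_mult param_unramified[OF False] by (simp add: algebra_simps)
  finally show ?thesis
    by (rule that[rotated])
      (intro germs_add germs_mult E_in_germs inverse_elem_in_germs val')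
next
  case True
  then obtain g where g: "E [:-a, 1:] = v ^ 2 * inverse (E g)" "inverse (E g) \<in> ring_units germs"
    by (rule linear_ramified)
  define W where "W = U div [:-a, 1:]"
  have W: "U = [:-a, 1:] * W"
    using assms True unfolding W_def val_def
    by (subst dvd_mult_div_cancel) (auto simp: poly_eq_0_iff_dvd[symmetric])
  have "E U = E [:-a, 1:] * E W"
    by (subst W) (rule E_mult)
  then have "elem U V = param * (v * E W * inverse (E g) + E V)"
    unfolding param_ramified[OF True] elem_def g by (simp add: power2_eq_square algebra_simps)
  then show ?thesis
    using g(2) by (intro that[rotated])
      (auto intro!: germs_add germs_mult E_in_germs v_in_germs simp: ring_units_def)
qed

lemma param_val: obtains U V where "param = elem U V" "val U V = 0"
proof (cases "b = 0")
  case True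
  then show ?thesis
    using that[of 0 1] unfolding param_ramified[OF True] elem_v val_v by blast
next
  case False
  then show ?thesis
    by (intro that[of "[:-a, 1:]" 0]) (simp_all add: param_unramified elem_poly val_poly)
qed

sublocale valuation_subring germs param
proof
  show "1 \<in> germs"
    using elem_in_germs[of 1 0] by (simp add: elem_one)
  obtain U V where p: "param = elem U V" "val U V = 0"
    by (rule param_val)
  show "param \<noteq> 0"
  proof (cases "b = 0")
    case True
    then show ?thesis
      using elem_eq_zero[of 0 1] unfolding param_ramified[OF True] elem_v by simp
  next
    case False
    then show ?thesis
      using elem_eq_zero[of "[:-a, 1:]" 0] by (simp add: param_unramified elem_poly)
  qed
  show "germs - ring_units germs = (\<lambda>x. param * x) ` germs" (is "?L = ?R")
  proof (intro equalityI subsetI)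
    fix x
    assume x: "x \<in> ?L"
    then obtain A B C D where x': "x = elem A B / elem C D" "val C D \<noteq> 0"
      by (auto simp: germs_def)
    have "val A B = 0"
    proof (rule ccontr)
      assume "val A B \<noteq> 0"
      then have "elem A B \<in> ring_units germs" "elem C D \<in> ring_units germs"
        using x' by (auto simp: elem_unit_iff)
      then have "x \<in> ring_units germs"
        unfolding x' ring_units_def by (auto simp: divide_inverse mult.commute intro: germs_mult)
      then show False using x by simp
    qed
    then obtain y where "y \<in> germs" "elem A B = param * y"
      by (rule param_dvd_elem)
    then show "x \<in> ?R"
      using x' by (auto simp: divide_inverse mult.assoc intro!: imageI germs_mult inverse_elem_in_germs)
  next
    fix x
    assume "x \<in> ?R"
    then obtain y where y: "y \<in> germs" "x = param * y" by blast
    then have xg: "x \<in> germs"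
      using p elem_in_germs germs_mult by metis
    obtain A B C D where y': "y = elem A B / elem C D" "val C D \<noteq> 0"
      using y by (auto simp: germs_def)
    have "x \<notin> ring_units germs"
    proof
      assume u: "x \<in> ring_units germs"
      have "elem C D \<in> ring_units germs"
        using y' by (simp add: elem_unit_iff)
      then have "x * elem C D \<in> ring_units germs"
        using u by (auto simp: ring_units_def germs_mult)
      moreover have "x * elem C D = elem U V * elem A B"
        using y y' p val_nonzero_imp_elem_nonzero[OF y'(2)] by simp
      ultimately have "val U V * val A B \<noteq> 0"
        by (simp add: elem_mult val_mult elem_unit_iff)
      then show False using p by simp
    qed
    then show "x \<in> ?L" using xg by simp
  qed
qed (auto intro: germs_add germs_mult germs_uminus)

end

section \<open>Orders of functions on a double cover\<close>


lemma map_poly_id_eq: "map_poly id p = p"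
  by (rule poly_eqI) (simp add: coeff_map_poly)

context double_cover_point
begin

abbreviation ramification :: int where
  "ramification \<equiv> (if b = 0 then 2 else 1)"

lemma v_has_ord: "b = 0 \<Longrightarrow> has_ord v 1"
  using has_ord_param param_ramified by metis

lemma linear_has_ord: "has_ord (E [:-a, 1:]) ramification"
proof (cases "b = 0")
  case True
  then obtain g where g: "E [:-a, 1:] = v ^ 2 * inverse (E g)" "inverse (E g) \<in> ring_units germs"
    by (rule linear_ramified)
  have "has_ord (v ^ 2 * inverse (E g)) (int 2 * 1 + 0)"
    using v_has_ord[OF True] g(2) by (intro has_ord_mult has_ord_power has_ord_unit)
  then show ?thesis
    unfolding g using True by simp
next
  case False
  then show ?thesis
    using has_ord_param unfolding param_unramified[OF False] by simp
qed

lemma poly_has_ord: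
  assumes "W \<noteq> 0"
  shows "has_ord (E W) (ramification * int (Polynomial.order a W))"
proof -
  obtain q where q: "W = [:-a, 1:] ^ Polynomial.order a W * q" "\<not> [:-a, 1:] dvd q"
    using order_decomp[OF assms, of a] by blast
  have "has_ord (E q) 0"
    using q(2) by (intro has_ord_unit) (simp add: poly_unit_iff poly_eq_0_iff_dvd)
  then have "has_ord (E [:-a, 1:] ^ Polynomial.order a W * E q) (int (Polynomial.order a W) * ramification + 0)"
    by (intro has_ord_mult has_ord_power linear_has_ord)
  then show ?thesis
    unfolding E_power[symmetric] E_mult[symmetric] q(1)[symmetric] by (simp add: mult.commute)
qed

lemma elem_common_factor: "elem (D * U) (D * V) = E D * elem U V"
  by (simp add: elem_def E_mult algebra_simps)

lemma elem_common_power_has_ord: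
  assumes "has_ord (elem U V) m"
  shows "has_ord (elem ([:-a, 1:] ^ k * U) ([:-a, 1:] ^ k * V)) (int k * ramification + m)"
  unfolding elem_common_factor E_power by (intro has_ord_mult has_ord_power linear_has_ord assms)

text \<open>The product of \<open>U + V v\<close> and its conjugate is the norm, a polynomial in \<open>u\<close> alone, whose order is
  visible from its factorization.\<close>

lemma elem_has_ord_norm_diff:
  assumes "has_ord (elem U (- V)) m" "U \<noteq> 0 \<or> V \<noteq> 0"
  shows "has_ord (elem U V) (ramification * int (Polynomial.order a (U ^ 2 - V ^ 2 * h)) - m)"
proof -
  have nz: "elem U (- V) \<noteq> 0" "elem U V \<noteq> 0"
    using assms(2) by (auto simp: elem_eq_zero)
  then have "U ^ 2 - V ^ 2 * h \<noteq> 0"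
    using elem_norm[of U V] E_zero by (metis mult_eq_0_iff)
  moreover have "elem U V = E (U ^ 2 - V ^ 2 * h) / elem U (- V)"
    using nz by (simp add: elem_norm[symmetric])
  ultimately show ?thesis
    using has_ord_divide[OF poly_has_ord assms(1)] by simp
qed

text \<open>At a branch point \<open>U\<close> has even and \<open>V v\<close> odd order, so nothing cancels and the conjugate
  \<open>U - V v\<close> has the same order as \<open>U + V v\<close>. Their product, the norm, has twice that order at the
  point, and this is twice its order in \<open>u - a\<close>, because \<open>u - a\<close> has order \<open>2\<close> at the point.\<close>

lemma elem_has_ord_ramified:
  assumes "b = 0" "U \<noteq> 0 \<or> V \<noteq> 0"
  shows "has_ord (elem U V) (int (Polynomial.order a (U ^ 2 - V ^ 2 * h)))"
proof -
  obtain k U' V' where k: "U = [:-a, 1:] ^ k * U'" "V = [:-a, 1:] ^ k * V'"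
    "poly U' a \<noteq> 0 \<or> poly V' a \<noteq> 0"
    using common_linear_power[OF assms(2)] by blast
  have *: "\<exists>m. has_ord (elem U' V') m \<and> has_ord (elem U' (- V')) m"
  proof (cases "poly U' a = 0")
    case False
    then have "val U' V' \<noteq> 0" "val U' (- V') \<noteq> 0"
      unfolding val_def using assms(1) by simp_all
    then show ?thesis
      using has_ord_unit elem_unit_iff by blast
  next
    case True
    then have "poly V' a \<noteq> 0" using k by auto
    then have "has_ord (E V' * v) (0 + 1)" "has_ord (E (- V') * v) (0 + 1)"
      using v_has_ord[OF assms(1)] by (intro has_ord_mult has_ord_unit; simp add: poly_unit_iff)+
    moreover have "U' = 0 \<or> (\<exists>l>1. has_ord (E U') l)"
    proof (cases "U' = 0")
      case nz: False
      then have "Polynomial.order a U' > 0"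
        using True by (simp add: order_gt_0_iff)
      then show ?thesis
        using poly_has_ord[OF nz] assms(1) by (intro disjI2 exI conjI) auto
    qed simp
    ultimately have "has_ord (E V' * v + E U') 1" "has_ord (E (- V') * v + E U') 1"
      using has_ord_add[of _ 1] by (auto simp: E_zero)
    then show ?thesis
      by (auto simp: elem_def add.commute)
  qed
  then obtain m where m: "has_ord (elem U' V') m" "has_ord (elem U' (- V')) m"
    by blast
  define m' where "m' = int k * ramification + m"
  have "has_ord (elem U V) m'"
    unfolding k m'_def by (rule elem_common_power_has_ord[OF m(1)])
  moreover have "has_ord (elem U (- V)) m'"
    using elem_common_power_has_ord[OF m(2)] unfolding k m'_def by simp
  ultimately have "m' = ramification * int (Polynomial.order a (U ^ 2 - V ^ 2 * h)) - m'"
    using elem_has_ord_norm_diff assms(2) has_ord_unique by blast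
  also have "ramification = 2"
    using assms(1) by simp
  finally have "m' = int (Polynomial.order a (U ^ 2 - V ^ 2 * h))"
    by simp
  then show ?thesis
    using \<open>has_ord (elem U V) m'\<close> by simp
qed

lemma opposite_point: "double_cover_point E v h a (- b)"
  using point_on_cover smooth
  by unfold_locales (auto simp: E_add E_mult E_one E_eq_zero_iff v_square h_nonzero irrational)

text \<open>Once the common power of \<open>u - a\<close> is removed, at most one of the two points over \<open>a\<close> is a zero. At the
  other one the order is the removed exponent, and the conjugate has that same order at the zero;
  the norm yields the order there.\<close>

lemma elem_has_ord_unramified:
  assumes b: "b \<noteq> 0" and nz: "U \<noteq> 0 \<or> V \<noteq> 0"
  obtains k l :: nat where "has_ord (elem U V) (int k)"
    "valuation_subring.has_ord (double_cover_point.germs E v a (- b))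
        (double_cover_point.param E v a (- b)) (elem U V) (int l)"
    "k + l = Polynomial.order a (U ^ 2 - V ^ 2 * h)"
proof -
  interpret opp: double_cover_point E v h a "- b"
    by (rule opposite_point)
  obtain k U' V' where k: "U = [:-a, 1:] ^ k * U'" "V = [:-a, 1:] ^ k * V'"
    "poly U' a \<noteq> 0 \<or> poly V' a \<noteq> 0"
    using common_linear_power[OF nz] by blast
  define N where "N = U ^ 2 - V ^ 2 * h"
  have low: "has_ord (elem U V) (int k)" if "val U' V' \<noteq> 0"
    using elem_common_power_has_ord[of U' V' 0 k] that b has_ord_unit elem_unit_iff k by auto
  have low': "opp.has_ord (elem U V) (int k)" if "opp.val U' V' \<noteq> 0"
    using opp.elem_common_power_has_ord[of U' V' 0 k] that b opp.has_ord_unit opp.elem_unit_iff k by auto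
  have high: "has_ord (elem U V) (int (Polynomial.order a N) - int k)" if "opp.val U' V' \<noteq> 0"
  proof -
    have "val U' (- V') \<noteq> 0" using that by (simp add: val_def opp.val_def)
    then have "has_ord (elem U (- V)) (int k)"
      using elem_common_power_has_ord[of U' "- V'" 0 k] b has_ord_unit elem_unit_iff k by auto
    from elem_has_ord_norm_diff[OF this nz] show ?thesis
      using b by (simp add: N_def)
  qed
  have high': "opp.has_ord (elem U V) (int (Polynomial.order a N) - int k)" if "val U' V' \<noteq> 0"
  proof -
    have "opp.val U' (- V') \<noteq> 0" using that by (simp add: val_def opp.val_def)
    then have "opp.has_ord (elem U (- V)) (int k)"
      using opp.elem_common_power_has_ord[of U' "- V'" 0 k] b opp.has_ord_unit opp.elem_unit_iff k by auto
    from opp.elem_has_ord_norm_diff[OF this nz] show ?thesis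
      using b by (simp add: N_def)
  qed
  have "val U' V' \<noteq> 0 \<or> opp.val U' V' \<noteq> 0"
  proof (rule ccontr)
    assume *: "\<not> ?thesis"
    then have "poly V' a * b + poly V' a * b = 0" "poly U' a + poly V' a * b = 0"
      by (auto simp: val_def opp.val_def algebra_simps eq_neg_iff_add_eq_0)
    then have "2 * (poly V' a * b) = 0" by (simp only: mult_2)
    then show False using k(3) b * by (auto simp: val_def)
  qed
  moreover have "int (Polynomial.order a N) - int k \<ge> 0"
  proof -
    have "elem U V \<in> germs" "elem U V \<in> opp.germs"
      by (rule elem_in_germs opp.elem_in_germs)+
    then show ?thesis
      using high high' mem_imp_has_ord_nonneg opp.mem_imp_has_ord_nonneg calculation by blast
  qed
  ultimately show ?thesis
    using that[of k "Polynomial.order a N - k"] that[of "Polynomial.order a N - k" k]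
      low low' high high' unfolding N_def by (fastforce simp: of_nat_diff)
qed

lemma elem_has_ord:
  assumes "U \<noteq> 0 \<or> V \<noteq> 0"
  obtains k :: nat where "has_ord (elem U V) (int k)"
  using elem_has_ord_ramified[OF _ assms] elem_has_ord_unramified[OF _ assms] by (metis that)

text \<open>A polynomial in two variables is reduced modulo \<open>v\<^sup>2 - h(u)\<close>. The coordinate functions and the
  coordinates of the point both satisfy this equation, so one reduction serves both evaluations.\<close>

lemma eval2_reduce:
  assumes E: "\<And>p. E p = poly (map_poly c p) u"
  shows "\<exists>U V. eval2 c F (u, v) = elem U V \<and> eval2 id F (a, b) = val U V"
proof -
  have ev: "eval2 c F (u, v) = poly (map_poly E F) v" for F
    unfolding eval2_def by (simp add: E[symmetric] cong: map_poly_cong)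
  have ev': "eval2 id F (a, b) = poly (map_poly (\<lambda>g. poly g a) F) b" for F
    unfolding eval2_def by (simp add: map_poly_id_eq)
  show ?thesis
  proof (induction F)
    case 0
    then show ?case
      by (intro exI[of _ 0]) (simp add: eval2_def elem_zero val_poly)
  next
    case (pCons g F)
    then obtain U V where UV: "eval2 c F (u, v) = elem U V" "eval2 id F (a, b) = val U V"
      by blast
    have "eval2 c (pCons g F) (u, v) = E g + v * elem U V"
      using UV by (simp add: ev map_poly_pCons E_zero)
    also have "\<dots> = elem (g + V * h) U"
      using elem_mult[of 0 1 U V] elem_add[of g 0 "V * h" U]
      by (simp add: elem_v elem_poly mult.commute)
    finally have 1: "eval2 c (pCons g F) (u, v) = elem (g + V * h) U" .
    have "eval2 id (pCons g F) (a, b) = poly g a + b * val U V"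
      using UV by (simp add: ev' map_poly_pCons)
    also have "\<dots> = val (g + V * h) U"
      using val_mult[of 0 1 U V] val_add[of g 0 "V * h" U]
      by (simp add: val_v val_poly mult.commute)
    finally show ?case using 1 by blast
  qed
qed

lemma eval2_linear:
  assumes E: "\<And>p. E p = poly (map_poly c p) u"
  shows "eval2 c [:U, V:] (u, v) = elem U V" "eval2 id [:U, V:] (a, b) = val U V"
proof -
  have ev: "eval2 c F (u, v) = poly (map_poly E F) v" for F
    unfolding eval2_def by (simp add: E[symmetric] cong: map_poly_cong)
  have ev': "eval2 id F (a, b) = poly (map_poly (\<lambda>g. poly g a) F) b" for F
    unfolding eval2_def by (simp add: map_poly_id_eq)
  show "eval2 c [:U, V:] (u, v) = elem U V"
    by (simp add: ev map_poly_pCons E_zero elem_def mult.commute)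
  show "eval2 id [:U, V:] (a, b) = val U V"
    by (simp add: ev' map_poly_pCons val_def mult.commute)
qed

lemma germs_eq_eval2:
  assumes E: "\<And>p. E p = poly (map_poly c p) u"
  shows "{eval2 c F (u, v) / eval2 c G (u, v) | F G. eval2 id G (a, b) \<noteq> 0} = germs" (is "?L = _")
proof (intro equalityI subsetI)
  fix x assume "x \<in> ?L"
  then obtain F G where x: "x = eval2 c F (u, v) / eval2 c G (u, v)" "eval2 id G (a, b) \<noteq> 0"
    by blast
  obtain U V U' V' where "eval2 c F (u, v) = elem U V" "eval2 c G (u, v) = elem U' V'"
    "eval2 id G (a, b) = val U' V'"
    using eval2_reduce[OF E] by meson
  then show "x \<in> germs"
    using x by (auto simp: germs_def)
next
  fix x assume "x \<in> germs"
  then obtain U V U' V' where x: "x = elem U V / elem U' V'" "val U' V' \<noteq> 0"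
    by (auto simp: germs_def)
  then show "x \<in> ?L"
    using eval2_linear[OF E, of U V] eval2_linear[OF E, of U' V'] by (smt (verit) mem_Collect_eq)
qed

lemma fractions_eq_eval2:
  assumes E: "\<And>p. E p = poly (map_poly c p) u"
  shows "{eval2 c F (u, v) / eval2 c G (u, v) | F G. eval2 c G (u, v) \<noteq> 0} =
    {elem U V / elem U' V' | U V U' V'. elem U' V' \<noteq> 0}" (is "?L = ?R")
proof (intro equalityI subsetI)
  fix x assume "x \<in> ?L"
  then obtain F G where x: "x = eval2 c F (u, v) / eval2 c G (u, v)" "eval2 c G (u, v) \<noteq> 0"
    by blast
  obtain U V U' V' where "eval2 c F (u, v) = elem U V" "eval2 c G (u, v) = elem U' V'"
    using eval2_reduce[OF E] by meson
  then show "x \<in> ?R"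
    using x by auto
next
  fix x assume "x \<in> ?R"
  then obtain U V U' V' where x: "x = elem U V / elem U' V'" "elem U' V' \<noteq> 0"
    by blast
  then show "x \<in> ?L"
    using eval2_linear[OF E, of U V] eval2_linear[OF E, of U' V'] by (smt (verit) mem_Collect_eq)
qed

end

section \<open>The curve and its function field\<close>


text \<open>The two charts of the curve substitute \<open>x\<close> and \<open>1/x\<close> in polynomials over the constants; reversing
  the coefficients of a polynomial passes from one to the other.\<close>

locale poly_substitution =
  fixes c :: "'a::field \<Rightarrow> 'k::field" and u :: 'k
  assumes c_add: "c (x + y) = c x + c y" and c_mult: "c (x * y) = c x * c y" and c_one: "c 1 = 1"
begin

definition subst_poly :: "'a poly \<Rightarrow> 'k" where
  "subst_poly p = poly (map_poly c p) u"

lemma c_zero: "c 0 = 0"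
  using c_add[of 0 0] by (metis add.right_neutral add_left_cancel)

lemma subst_pCons: "subst_poly (pCons a p) = c a + u * subst_poly p"
  by (simp add: subst_poly_def map_poly_pCons c_zero)

lemma subst_zero: "subst_poly 0 = 0"
  by (simp add: subst_poly_def)

lemma subst_add: "subst_poly (p + q) = subst_poly p + subst_poly q"
  by (induction p q rule: poly_induct2)
    (simp_all add: subst_pCons subst_zero c_add algebra_simps)

lemma subst_smult: "subst_poly (Polynomial.smult a p) = c a * subst_poly p"
  by (induction p) (simp_all add: subst_pCons subst_zero c_mult algebra_simps)

lemma subst_mult: "subst_poly (p * q) = subst_poly p * subst_poly q"
  by (induction p)
    (simp_all add: subst_pCons subst_zero subst_add subst_smult c_zero algebra_simps)

lemma subst_one: "subst_poly 1 = 1"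
  using subst_pCons[of 1 0] by (simp add: subst_zero c_one one_pCons)

end

lemma const_hom:
  "const (x + y) = const x + const y" "const (x * y) = const x * const y" "const 1 = 1"
  by (simp_all add: const_def to_ac_add[symmetric] to_ac_mult[symmetric] One_fract_def[symmetric]
      one_pCons[symmetric] del: to_ac_add to_ac_mult) (simp add: mult.commute)

interpretation at_x: poly_substitution const x_fn
  by unfold_locales (rule const_hom)+

interpretation at_inverse_x: poly_substitution const "1 / x_fn"
  by unfold_locales (rule const_hom)+

lemma const_eq_zero_iff: "const c = 0 \<longleftrightarrow> c = 0"
proof -
  have "const c = 0 \<longleftrightarrow> Fract [:c:] 1 = 0"
    by (simp only: const_def to_ac_eq_0_iff)
  also have "\<dots> \<longleftrightarrow> c = 0"
    unfolding Zero_fract_def by (subst eq_fract) simp_all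
  finally show ?thesis .
qed

lemma at_x_eq: "at_x.subst_poly p = to_ac (Fract p 1)"
proof (induction p)
  case 0
  then show ?case by (simp add: at_x.subst_zero Zero_fract_def[symmetric])
next
  case (pCons c p)
  have "Fract (pCons c p) 1 = Fract [:c:] 1 + Fract [:0, 1:] 1 * Fract p 1"
    by simp
  then have "to_ac (Fract (pCons c p) 1) = const c + x_fn * to_ac (Fract p 1)"
    unfolding const_def x_fn_def by (simp only: to_ac_add to_ac_mult)
  then show ?case
    using pCons by (simp add: at_x.subst_pCons)
qed

lemma at_x_eq_zero_iff: "at_x.subst_poly p = 0 \<longleftrightarrow> p = 0"
proof -
  have "at_x.subst_poly p = 0 \<longleftrightarrow> Fract p 1 = 0"
    by (simp only: at_x_eq to_ac_eq_0_iff)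
  also have "\<dots> \<longleftrightarrow> p = 0"
    unfolding Zero_fract_def by (subst eq_fract) simp_all
  finally show ?thesis .
qed

lemma x_fn_nonzero: "x_fn \<noteq> 0"
  unfolding x_fn_def to_ac_eq_0_iff Zero_fract_def by (subst eq_fract) simp_all

lemma degree_map_poly_const: "degree (map_poly const p) = degree p"
  by (rule degree_map_poly) (simp add: const_eq_zero_iff)

lemma map_poly_const_reflect:
  "map_poly const (reflect_poly p) = reflect_poly (map_poly const p)"
  by (intro poly_eqI)
    (simp add: coeff_map_poly coeff_reflect_poly const_eq_zero_iff degree_map_poly_const)

lemma at_x_reflect: "at_x.subst_poly (reflect_poly p) = x_fn ^ degree p * at_inverse_x.subst_poly p"
  using poly_reflect_poly_nz[OF x_fn_nonzero, of "map_poly const p"]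
  by (simp add: at_x.subst_poly_def at_inverse_x.subst_poly_def map_poly_const_reflect
      degree_map_poly_const inverse_eq_divide)

lemma at_inverse_x_reflect:
  "at_x.subst_poly p = x_fn ^ degree p * at_inverse_x.subst_poly (reflect_poly p)"
proof -
  have nz: "1 / x_fn \<noteq> (0 :: 'a poly fract alg_closure)"
    by (simp add: x_fn_nonzero)
  have "at_inverse_x.subst_poly (reflect_poly p) = (1 / x_fn) ^ degree p * at_x.subst_poly p"
    using poly_reflect_poly_nz[OF nz, of "map_poly const p"]
    by (simp add: at_x.subst_poly_def at_inverse_x.subst_poly_def map_poly_const_reflect
        degree_map_poly_const)
  then show ?thesis
    by (simp add: power_one_over x_fn_nonzero)
qed

lemma at_inverse_x_eq_zero_iff: "at_inverse_x.subst_poly p = 0 \<longleftrightarrow> p = 0"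
  using at_x_reflect[of p] at_x_eq_zero_iff[of "reflect_poly p"] x_fn_nonzero
  by (auto simp: at_inverse_x.subst_zero)

lemma y_fn_square: "y_fn f ^ 2 = at_x.subst_poly f"
proof -
  have "\<exists>y. y ^ 2 = to_ac (Fract f 1)"
    using nth_root_exists[of 2 "to_ac (Fract f 1)"] by auto
  then show ?thesis
    unfolding y_fn_def at_x_eq by (rule someI_ex)
qed

text \<open>At a branch point and at infinity the local parameter is the second coordinate of the chart, which
  vanishes to order \<open>1\<close> there.\<close>

fun pt_param :: "'a::field poly \<Rightarrow> 'a point \<Rightarrow> 'a poly fract alg_closure" where
  "pt_param f (Affine a b) = (if b = 0 then y_fn f else at_x.subst_poly [:-a, 1:])"
| "pt_param f Infinity = y_fn f / x_fn ^ (genus f + 1)"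

locale odd_hyperelliptic =
  fixes f :: "'a::{alg_closed_field, field_char_0} poly" and \<gamma> :: nat
  assumes degree_f: "degree f = 2 * \<gamma> + 1"
    and separable: "coprime f (pderiv f)"
begin

lemma genus_f: "genus f = \<gamma>"
  by (simp add: genus_def degree_f)

lemma f_nonzero: "f \<noteq> 0"
  using degree_f by auto

lemma simple_root:
  assumes "poly f a = 0"
  shows "Polynomial.order a f = 1"
proof -
  have "rsquarefree f"
    unfolding rsquarefree_roots
  proof (intro allI notI)
    fix r
    assume "poly f r = 0 \<and> poly (pderiv f) r = 0"
    then have "[:-r, 1:] dvd 1"
      using separable by (auto simp: poly_eq_0_iff_dvd coprime_def)
    then show False
      by (auto simp: poly_eq_0_iff_dvd[symmetric])
  qed
  then have "Polynomial.order a f = 0 \<or> Polynomial.order a f = 1"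
    by (simp add: rsquarefree_def)
  then show ?thesis
    using assms f_nonzero by (simp add: order_root)
qed

lemma exists_root: "\<exists>r. poly f r = 0"
  using alg_closed_imp_poly_has_root[of f] degree_f by auto

lemma affine_cover:
  assumes "Affine a b \<in> curve f"
  shows "double_cover_point at_x.subst_poly (y_fn f) f a b"
proof -
  have ab: "b ^ 2 = poly f a"
    using assms by (simp add: curve_def)
  show ?thesis
  proof
    show "b ^ 2 = poly f a" by (rule ab)
    show "b = 0 \<Longrightarrow> Polynomial.order a f = 1"
      using ab by (intro simple_root) simp
    obtain r where "poly f r = 0" using exists_root by blast
    then show "\<exists>r. odd (Polynomial.order r f)"
      by (intro exI[of _ r]) (simp add: simple_root)
  qed (auto simp: at_x.subst_add at_x.subst_mult at_x.subst_one at_x_eq_zero_iff y_fn_square f_nonzero)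
qed

text \<open>The chart at infinity is the double cover \<open>v\<^sup>2 = u\<^bsup>2\<gamma>+2\<^esup> f(1/u)\<close> of the line with coordinate \<open>u = 1/x\<close>;
  as \<open>f\<close> has odd degree, it is branched over \<open>u = 0\<close>.\<close>

definition v_inf :: "'a poly fract alg_closure" where
  "v_inf = y_fn f / x_fn ^ (\<gamma> + 1)"

definition f_inf :: "'a poly" where
  "f_inf = pCons 0 (reflect_poly f)"

lemma infinity_cover: "double_cover_point at_inverse_x.subst_poly v_inf f_inf 0 0"
proof
  have "y_fn f ^ 2 = x_fn ^ (2 * \<gamma> + 1) * at_inverse_x.subst_poly (reflect_poly f)"
    by (simp add: y_fn_square at_inverse_x_reflect degree_f)
  then have "v_inf ^ 2 = x_fn ^ (2 * \<gamma> + 1) * at_inverse_x.subst_poly (reflect_poly f) / x_fn ^ (2 * \<gamma> + 2)"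
    by (simp add: v_inf_def power_divide power_mult[symmetric] mult.commute del: power_Suc)
  then show "v_inf ^ 2 = at_inverse_x.subst_poly f_inf"
    using x_fn_nonzero by (simp add: f_inf_def at_inverse_x.subst_pCons at_inverse_x.c_zero)
  have ord: "Polynomial.order 0 f_inf = 1"
    using order_linear_power_mult[of "reflect_poly f" 0 1] f_nonzero by (simp add: f_inf_def)
  show "Polynomial.order 0 f_inf = 1" by (rule ord)
  show "\<exists>r. odd (Polynomial.order r f_inf)"
    using ord by (intro exI[of _ 0]) simp
qed (auto simp: at_inverse_x.subst_add at_inverse_x.subst_mult at_inverse_x.subst_one
    at_inverse_x_eq_zero_iff f_inf_def f_nonzero)

lemma local_ring_affine:
  assumes "Affine a b \<in> curve f"
  shows "local_ring f (Affine a b) = double_cover_point.germs at_x.subst_poly (y_fn f) a b"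
  unfolding local_ring_def chart.simps coords.simps
  by (rule double_cover_point.germs_eq_eval2[OF affine_cover[OF assms] at_x.subst_poly_def])

lemma local_ring_infinity:
  "local_ring f Infinity = double_cover_point.germs at_inverse_x.subst_poly v_inf 0 0"
  unfolding local_ring_def chart.simps coords.simps genus_f v_inf_def[symmetric]
  by (rule double_cover_point.germs_eq_eval2[OF infinity_cover at_inverse_x.subst_poly_def])

lemma pt_param_affine:
  assumes "Affine a b \<in> curve f"
  shows "pt_param f (Affine a b) = double_cover_point.param at_x.subst_poly (y_fn f) a b"
  by (simp add: double_cover_point.param_def[OF affine_cover[OF assms]])

lemma pt_param_infinity:
  "pt_param f Infinity = double_cover_point.param at_inverse_x.subst_poly v_inf 0 0"
  unfolding double_cover_point.param_def[OF infinity_cover] by (simp add: v_inf_def genus_f)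

definition pt_ord :: "'a point \<Rightarrow> 'a poly fract alg_closure \<Rightarrow> int \<Rightarrow> bool" where
  "pt_ord P = valuation_subring.has_ord (local_ring f P) (pt_param f P)"

lemma local_ring_valuation:
  assumes "P \<in> curve f"
  shows "valuation_subring (local_ring f P) (pt_param f P)"
proof (cases P)
  case (Affine a b)
  interpret double_cover_point at_x.subst_poly "y_fn f" f a b
    using affine_cover assms Affine by simp
  show ?thesis
    using valuation_subring_axioms assms Affine local_ring_affine pt_param_affine by simp
next
  case Infinity
  interpret double_cover_point at_inverse_x.subst_poly v_inf f_inf 0 0
    by (rule infinity_cover)
  show ?thesis
    unfolding Infinity local_ring_infinity pt_param_infinity by (rule valuation_subring_axioms)
qed

lemma ord_at_eq:
  assumes "P \<in> curve f" "pt_ord P \<phi> m"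
  shows "ord_at f P \<phi> = m"
proof -
  have "local_units f P = ring_units (local_ring f P)"
    by (simp add: local_units_def ring_units_def)
  then show ?thesis
    using valuation_subring.order_independent_of_uniformizer[OF local_ring_valuation[OF assms(1)]] assms(2)
    unfolding ord_at_def uniformizer_def max_ideal_def pt_ord_def by simp
qed

definition fn :: "'a poly \<Rightarrow> 'a poly \<Rightarrow> 'a poly fract alg_closure" where
  "fn U V = at_x.subst_poly U + at_x.subst_poly V * y_fn f"

lemma elem_affine:
  assumes "Affine a b \<in> curve f"
  shows "double_cover_point.elem at_x.subst_poly (y_fn f) = fn"
  using double_cover_point.elem_def[OF affine_cover[OF assms]] by (intro ext) (simp add: fn_def)

lemma exists_affine_point: "\<exists>a b. Affine a b \<in> curve f"
proof -
  obtain b where "b ^ 2 = poly f 0"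
    using nth_root_exists[of 2 "poly f 0"] by auto
  then show ?thesis
    by (intro exI[of _ 0] exI[of _ b]) (simp add: curve_def)
qed

lemma fn_mult: "fn U V * fn U' V' = fn (U * U' + V * V' * f) (U * V' + V * U')"
  and fn_norm: "fn U V * fn U (- V) = at_x.subst_poly (U ^ 2 - V ^ 2 * f)"
  and fn_eq_zero: "fn U V = 0 \<longleftrightarrow> U = 0 \<and> V = 0"
  and fn_poly: "fn U 0 = at_x.subst_poly U"
  and function_field_eq: "function_field f = {fn U V / fn U' V' | U V U' V'. fn U' V' \<noteq> 0}"
proof -
  obtain a b where ab: "Affine a b \<in> curve f" using exists_affine_point by blast
  interpret double_cover_point at_x.subst_poly "y_fn f" f a b
    by (rule affine_cover[OF ab])
  note e = elem_affine[OF ab]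
  show "fn U V * fn U' V' = fn (U * U' + V * V' * f) (U * V' + V * U')"
    "fn U V * fn U (- V) = at_x.subst_poly (U ^ 2 - V ^ 2 * f)"
    "fn U V = 0 \<longleftrightarrow> U = 0 \<and> V = 0"
    "fn U 0 = at_x.subst_poly U"
    using elem_mult elem_norm elem_eq_zero elem_poly unfolding e by blast+
  show "function_field f = {fn U V / fn U' V' | U V U' V'. fn U' V' \<noteq> 0}"
    using fractions_eq_eval2[OF at_x.subst_poly_def] unfolding e function_field_def .
qed

lemma pt_ord_affine:
  assumes "Affine a b \<in> curve f"
  shows "pt_ord (Affine a b) = valuation_subring.has_ord
    (double_cover_point.germs at_x.subst_poly (y_fn f) a b)
    (double_cover_point.param at_x.subst_poly (y_fn f) a b)"
  unfolding pt_ord_def local_ring_affine[OF assms] pt_param_affine[OF assms] ..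

lemma fn_ord_affine:
  assumes "Affine a b \<in> curve f" "U \<noteq> 0 \<or> V \<noteq> 0"
  obtains k :: nat where "pt_ord (Affine a b) (fn U V) (int k)"
proof -
  interpret double_cover_point at_x.subst_poly "y_fn f" f a b
    by (rule affine_cover[OF assms(1)])
  show ?thesis
    using elem_has_ord[OF assms(2)] that
    unfolding pt_ord_affine[OF assms(1)] elem_affine[OF assms(1)] by blast
qed

text \<open>With \<open>u = 1/x\<close> of order \<open>2\<close> and \<open>v = y/x\<^bsup>\<gamma>+1\<^esup>\<close> of order \<open>1\<close>, a polynomial \<open>U\<close> in \<open>x\<close> is
  \<open>u\<^bsup>-deg U\<^esup>\<close> times the reversed polynomial in \<open>u\<close>, which is a unit because its constant term is the
  leading coefficient of \<open>U\<close>.\<close>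

lemma infinity_ord:
  shows poly_ord_infinity: "U \<noteq> 0 \<Longrightarrow> pt_ord Infinity (at_x.subst_poly U) (- 2 * int (degree U))"
    and y_ord_infinity: "pt_ord Infinity (y_fn f) (- (2 * int \<gamma> + 1))"
proof -
  interpret double_cover_point at_inverse_x.subst_poly v_inf f_inf 0 0
    by (rule infinity_cover)
  have p: "pt_ord Infinity = has_ord"
    unfolding pt_ord_def local_ring_infinity pt_param_infinity ..
  have "has_ord (1 / x_fn) 2"
    using linear_has_ord by (simp add: at_inverse_x.subst_pCons at_inverse_x.subst_zero
        at_inverse_x.c_zero at_inverse_x.c_one)
  then have x: "has_ord x_fn (- 2)"
    using has_ord_inverse by fastforce
  show "pt_ord Infinity (at_x.subst_poly U) (- 2 * int (degree U))" if "U \<noteq> 0"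
  proof -
    have "has_ord (at_inverse_x.subst_poly (reflect_poly U)) 0"
      using that by (intro has_ord_unit) (simp add: poly_unit_iff)
    from has_ord_mult[OF has_ord_power[OF x, of "degree U"] this] show ?thesis
      by (simp add: p at_inverse_x_reflect[of U] mult.commute)
  qed
  have "has_ord (v_inf * x_fn ^ (\<gamma> + 1)) (1 + int (\<gamma> + 1) * (- 2))"
    by (intro has_ord_mult has_ord_power x v_has_ord) simp
  moreover have "v_inf * x_fn ^ (\<gamma> + 1) = y_fn f"
    by (simp add: v_inf_def x_fn_nonzero)
  ultimately show "pt_ord Infinity (y_fn f) (- (2 * int \<gamma> + 1))"
    by (simp add: p algebra_simps)
qed

end

section \<open>Zeros and poles of functions on the curve\<close>


lemma sum_order_eq_degree:
  fixes p :: "'a::alg_closed_field poly"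
  assumes "p \<noteq> 0"
  shows "(\<Sum>a | poly p a = 0. Polynomial.order a p) = degree p"
proof -
  obtain A where A: "size A = degree p" "p = Polynomial.smult (lead_coeff p) (\<Prod>x\<in>#A. [:-x, 1:])"
    using alg_closed_imp_factorization[OF assms] by blast
  have "proots p = proots (\<Prod>x\<in>#A. [:-x, 1:])"
    using assms by (subst A(2)) (simp add: proots_smult)
  also have "\<dots> = A"
  proof -
    have "0 \<notin># image_mset (\<lambda>x. [:-x, 1:]) A"
      by (auto simp: eq_commute[of "0 :: 'a poly"])
    from proots_prod_mset[OF this] show ?thesis
      by (simp add: image_mset.compositionality o_def)
  qed
  finally have "proots p = A" .
  then have "degree p = size (proots p)"
    using A(1) by simp
  also have "\<dots> = (\<Sum>a | poly p a = 0. Polynomial.order a p)"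
    using assms by (simp add: size_multiset_overloaded_eq)
  finally show ?thesis ..
qed

context double_cover_point
begin

text \<open>The order of \<open>U + V v\<close> at a branch point is that of the norm \<open>U\<^sup>2 - V\<^sup>2 h\<close>, and the two terms of the
  norm have orders of different parity.\<close>

lemma ramified_order_ge_2_imp_root:
  assumes "b = 0" "has_ord (elem U V) m" "m \<ge> 2"
  shows "poly U a = 0 \<and> poly V a = 0"
proof -
  define N where "N = U ^ 2 - V ^ 2 * h"
  have nz: "U \<noteq> 0 \<or> V \<noteq> 0"
    using has_ord_nonzero[OF assms(2)] by (simp add: elem_eq_zero)
  have "m = int (Polynomial.order a N)"
    using elem_has_ord_ramified[OF assms(1) nz] assms(2) has_ord_unique unfolding N_def by blast
  then have dvdN: "[:-a, 1:] ^ 2 dvd N"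
    using assms(3) by (simp add: order_divides)
  have ha: "poly h a = 0"
    using point_on_cover assms(1) by simp
  have "poly N a = 0"
    using dvd_trans[OF dvd_power[of 2 "[:-a, 1:]"] dvdN] by (simp add: poly_eq_0_iff_dvd)
  then have Ua: "poly U a = 0"
    by (simp add: N_def ha)
  then have "[:-a, 1:] ^ 2 dvd U ^ 2"
    by (intro dvd_power_same) (simp add: poly_eq_0_iff_dvd)
  then have "[:-a, 1:] ^ 2 dvd U ^ 2 - N"
    using dvdN by (rule dvd_diff)
  then have d: "[:-a, 1:] ^ 2 dvd V ^ 2 * h"
    by (simp add: N_def)
  have "poly V a = 0"
  proof (cases "V = 0")
    case False
    then have "Polynomial.order a (V ^ 2 * h) = 2 * Polynomial.order a V + 1"
      using h_nonzero smooth[OF assms(1)] by (simp add: order_mult power2_eq_square)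
    moreover have "2 \<le> Polynomial.order a (V ^ 2 * h)"
      using d False h_nonzero by (simp add: order_divides)
    ultimately show ?thesis
      using False by (simp add: order_root)
  qed simp
  then show ?thesis using Ua by simp
qed

lemma positive_order_imp_val_zero:
  assumes "has_ord (elem U V) m" "m > 0"
  shows "val U V = 0"
proof (rule ccontr)
  assume "val U V \<noteq> 0"
  then have "has_ord (elem U V) 0"
    using elem_unit_iff has_ord_unit by blast
  then show False
    using assms has_ord_unique by fastforce
qed

end

context odd_hyperelliptic
begin

text \<open>Up to sign this is the order of \<open>U + V y\<close> at infinity; the case distinction gives the zero
  polynomial no pole.\<close>

definition pole_order :: "'a poly \<Rightarrow> 'a poly \<Rightarrow> nat" where
  "pole_order U V = max (2 * degree U) (if V = 0 then 0 else 2 * degree V + 2 * \<gamma> + 1)"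

text \<open>\<open>U\<^sup>2\<close> has even and \<open>V\<^sup>2 f\<close> odd degree, so their leading terms cannot cancel.\<close>

lemma degree_norm: "degree (U ^ 2 - V ^ 2 * f) = pole_order U V"
proof (cases "V = 0")
  case True
  then show ?thesis
    by (cases "U = 0") (simp_all add: pole_order_def degree_power_eq)
next
  case V: False
  have dV: "degree (V ^ 2 * f) = 2 * degree V + 2 * \<gamma> + 1"
    using V f_nonzero by (simp add: degree_mult_eq degree_power_eq degree_f)
  have dU: "degree (U ^ 2) = 2 * degree U"
    by (cases "U = 0") (simp_all add: degree_power_eq)
  consider "2 * degree U < 2 * degree V + 2 * \<gamma> + 1" | "2 * degree U > 2 * degree V + 2 * \<gamma> + 1"
    by (metis Suc_eq_plus1 add_mult_distrib2 double_not_eq_Suc_double linorder_neqE_nat)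
  then show ?thesis
  proof cases
    case 1
    then have "degree (U ^ 2 + - (V ^ 2 * f)) = degree (- (V ^ 2 * f))"
      by (intro degree_add_eq_right) (simp add: dU dV)
    then show ?thesis using 1 V by (simp add: dV pole_order_def)
  next
    case 2
    then have "degree (U ^ 2 + - (V ^ 2 * f)) = degree (U ^ 2)"
      by (intro degree_add_eq_left) (simp add: dU dV)
    then show ?thesis using 2 V by (simp add: dU pole_order_def)
  qed
qed

lemma infinity_on_curve: "Infinity \<in> curve f"
  by (simp add: curve_def)

lemma affine_on_curve: "Affine a b \<in> curve f \<longleftrightarrow> b ^ 2 = poly f a"
  by (simp add: curve_def)

lemma pt_ord_rules:
  assumes "P \<in> curve f"
  shows pt_ord_mult: "pt_ord P \<phi> m \<Longrightarrow> pt_ord P \<psi> l \<Longrightarrow> pt_ord P (\<phi> * \<psi>) (m + l)"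
    and pt_ord_divide: "pt_ord P \<phi> m \<Longrightarrow> pt_ord P \<psi> l \<Longrightarrow> pt_ord P (\<phi> / \<psi>) (m - l)"
    and pt_ord_unique: "pt_ord P \<phi> m \<Longrightarrow> pt_ord P \<phi> l \<Longrightarrow> m = l"
    and pt_ord_add: "pt_ord P \<phi> m \<Longrightarrow> pt_ord P \<psi> l \<Longrightarrow> m < l \<Longrightarrow> pt_ord P (\<phi> + \<psi>) m"
proof -
  interpret valuation_subring "local_ring f P" "pt_param f P"
    by (rule local_ring_valuation[OF assms])
  show "pt_ord P \<phi> m \<Longrightarrow> pt_ord P \<psi> l \<Longrightarrow> pt_ord P (\<phi> * \<psi>) (m + l)"
    "pt_ord P \<phi> m \<Longrightarrow> pt_ord P \<psi> l \<Longrightarrow> pt_ord P (\<phi> / \<psi>) (m - l)"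
    "pt_ord P \<phi> m \<Longrightarrow> pt_ord P \<phi> l \<Longrightarrow> m = l"
    "pt_ord P \<phi> m \<Longrightarrow> pt_ord P \<psi> l \<Longrightarrow> m < l \<Longrightarrow> pt_ord P (\<phi> + \<psi>) m"
    unfolding pt_ord_def
    by (rule has_ord_mult has_ord_divide has_ord_unique has_ord_add; assumption)+
qed

lemma fn_ord_infinity:
  assumes "U \<noteq> 0 \<or> V \<noteq> 0"
  shows "pt_ord Infinity (fn U V) (- int (pole_order U V))"
proof (cases "V = 0")
  case True
  then show ?thesis
    using poly_ord_infinity[of U] assms by (simp add: fn_def pole_order_def at_x.subst_zero)
next
  case V: False
  have Vy: "pt_ord Infinity (at_x.subst_poly V * y_fn f) (- 2 * int (degree V) + - (2 * int \<gamma> + 1))"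
    by (rule pt_ord_mult[OF infinity_on_curve poly_ord_infinity[OF V] y_ord_infinity])
  show ?thesis
  proof (cases "U = 0")
    case True
    then show ?thesis
      using Vy V by (simp add: fn_def pole_order_def at_x.subst_zero algebra_simps)
  next
    case U: False
    consider "2 * degree U < 2 * degree V + 2 * \<gamma> + 1" | "2 * degree U > 2 * degree V + 2 * \<gamma> + 1"
      by (metis Suc_eq_plus1 add_mult_distrib2 double_not_eq_Suc_double linorder_neqE_nat)
    then show ?thesis
    proof cases
      case 1
      then show ?thesis
        using pt_ord_add[OF infinity_on_curve Vy poly_ord_infinity[OF U]] V
        by (simp add: fn_def pole_order_def add.commute algebra_simps)
    next
      case 2
      then show ?thesis
        using pt_ord_add[OF infinity_on_curve poly_ord_infinity[OF U] Vy] V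
        by (simp add: fn_def pole_order_def algebra_simps)
    qed
  qed
qed

lemma fn_in_function_field: "fn U V \<in> function_field f"
proof -
  have "fn U V = fn U V / fn 1 0" "fn 1 0 \<noteq> (0 :: 'a poly fract alg_closure)"
    by (simp_all add: fn_poly at_x.subst_one)
  then show ?thesis
    unfolding function_field_eq by blast
qed

lemma function_field_mult:
  assumes "\<phi> \<in> function_field f" "\<psi> \<in> function_field f"
  shows "\<phi> * \<psi> \<in> function_field f"
proof -
  obtain U V U' V' where 1: "\<phi> = fn U V / fn U' V'" "fn U' V' \<noteq> 0"
    using assms function_field_eq by auto
  obtain A B A' B' where 2: "\<psi> = fn A B / fn A' B'" "fn A' B' \<noteq> 0"
    using assms function_field_eq by auto
  have "\<phi> * \<psi> = (fn U V * fn A B) / (fn U' V' * fn A' B')" "fn U' V' * fn A' B' \<noteq> 0"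
    using 1 2 by simp_all
  then show ?thesis
    unfolding function_field_eq fn_mult by blast
qed

lemma function_field_inverse:
  assumes "\<phi> \<in> function_field f" "\<phi> \<noteq> 0"
  shows "inverse \<phi> \<in> function_field f"
proof -
  obtain U V U' V' where 1: "\<phi> = fn U V / fn U' V'" "fn U' V' \<noteq> 0"
    using assms function_field_eq by auto
  then have "inverse \<phi> = fn U' V' / fn U V" "fn U V \<noteq> 0"
    using assms by auto
  then show ?thesis
    unfolding function_field_eq by blast
qed

lemma exists_fn_ord:
  assumes "P \<in> curve f" "U \<noteq> 0 \<or> V \<noteq> 0"
  shows "\<exists>m. pt_ord P (fn U V) m"
proof (cases P)
  case (Affine a b)
  then show ?thesis using assms fn_ord_affine by metis
next
  case Infinity
  then show ?thesis using assms fn_ord_infinity by metis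
qed

lemma pt_ord_ord_at:
  assumes "P \<in> curve f" "\<phi> \<in> function_field f" "\<phi> \<noteq> 0"
  shows "pt_ord P \<phi> (ord_at f P \<phi>)"
proof -
  obtain U V U' V' where 1: "\<phi> = fn U V / fn U' V'" "fn U' V' \<noteq> 0"
    using assms function_field_eq by auto
  then have "U \<noteq> 0 \<or> V \<noteq> 0" "U' \<noteq> 0 \<or> V' \<noteq> 0"
    using assms(3) by (auto simp: fn_eq_zero)
  then obtain m l where "pt_ord P (fn U V) m" "pt_ord P (fn U' V') l"
    using exists_fn_ord[OF assms(1)] by meson
  then have "pt_ord P \<phi> (m - l)"
    unfolding 1 by (rule pt_ord_divide[OF assms(1)])
  then show ?thesis
    using ord_at_eq[OF assms(1)] by metis
qed

lemma poly_ord_affine: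
  assumes "Affine a b \<in> curve f" "W \<noteq> 0"
  shows "pt_ord (Affine a b) (at_x.subst_poly W) ((if b = 0 then 2 else 1) * int (Polynomial.order a W))"
proof -
  interpret double_cover_point at_x.subst_poly "y_fn f" f a b
    by (rule affine_cover[OF assms(1)])
  show ?thesis
    unfolding pt_ord_affine[OF assms(1)] by (rule poly_has_ord[OF assms(2)])
qed

text \<open>At affine points the order of \<open>U + V y\<close> is non-negative, so \<open>nat\<close> loses nothing there.\<close>

definition zero_mult :: "'a poly \<Rightarrow> 'a poly \<Rightarrow> 'a point \<Rightarrow> nat" where
  "zero_mult U V P = nat (ord_at f P (fn U V))"

lemma zero_mult_ord:
  assumes "Affine a b \<in> curve f" "U \<noteq> 0 \<or> V \<noteq> 0"
  shows "pt_ord (Affine a b) (fn U V) (int (zero_mult U V (Affine a b)))"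
proof -
  obtain k :: nat where "pt_ord (Affine a b) (fn U V) (int k)"
    using fn_ord_affine[OF assms] by blast
  then show ?thesis
    using ord_at_eq[OF assms(1)] by (simp add: zero_mult_def)
qed

lemma sum_zero_mult_fibre:
  assumes "U \<noteq> 0 \<or> V \<noteq> 0"
  shows "(\<Sum>b | b ^ 2 = poly f a. zero_mult U V (Affine a b)) = Polynomial.order a (U ^ 2 - V ^ 2 * f)"
proof -
  obtain b where b: "b ^ 2 = poly f a"
    using nth_root_exists[of 2 "poly f a"] by auto
  have fibre: "{b'. b' ^ 2 = poly f a} = {b, - b}"
    unfolding b[symmetric] by (auto simp: power2_eq_iff)
  have on: "Affine a b \<in> curve f" "Affine a (- b) \<in> curve f"
    using b by (simp_all add: affine_on_curve)
  interpret double_cover_point at_x.subst_poly "y_fn f" f a b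
    by (rule affine_cover[OF on(1)])
  show ?thesis
  proof (cases "b = 0")
    case True
    have "pt_ord (Affine a b) (fn U V) (int (Polynomial.order a (U ^ 2 - V ^ 2 * f)))"
      using elem_has_ord_ramified[OF True assms] unfolding pt_ord_affine[OF on(1)] elem_affine[OF on(1)] .
    then show ?thesis
      unfolding fibre using zero_mult_ord[OF on(1) assms] pt_ord_unique[OF on(1)] True by fastforce
  next
    case False
    obtain k l :: nat where kl: "pt_ord (Affine a b) (fn U V) (int k)"
      "pt_ord (Affine a (- b)) (fn U V) (int l)" "k + l = Polynomial.order a (U ^ 2 - V ^ 2 * f)"
      using elem_has_ord_unramified[OF False assms]
      unfolding pt_ord_affine[OF on(1)] pt_ord_affine[OF on(2)] elem_affine[OF on(1)] by metis
    have "zero_mult U V (Affine a b) = k" "zero_mult U V (Affine a (- b)) = l"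
      using ord_at_eq[OF on(1) kl(1)] ord_at_eq[OF on(2) kl(2)] by (simp_all add: zero_mult_def)
    moreover have "b \<noteq> - b"
      using False by (metis add.inverse_neutral add_eq_0_iff mult_2 mult_eq_0_iff zero_neq_numeral)
    ultimately show ?thesis
      unfolding fibre using kl(3) by simp
  qed
qed

text \<open>The degree of the norm is the order of the pole at infinity, and it is also the number of roots of
  the norm, that is, of zeros of the function counted fibre by fibre. This is the fact that principal
  divisors have degree \<open>0\<close>, for functions with their only pole at infinity.\<close>

lemma zero_multiset:
  assumes nz: "U \<noteq> 0 \<or> V \<noteq> 0"
  obtains M where "set_mset M \<subseteq> curve f - {Infinity}" "size M = pole_order U V"
    "\<And>a b. Affine a b \<in> curve f \<Longrightarrow> pt_ord (Affine a b) (fn U V) (int (count M (Affine a b)))"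
proof -
  define N where "N = U ^ 2 - V ^ 2 * f"
  have "fn U V * fn U (- V) \<noteq> 0"
    using nz by (auto simp: fn_eq_zero)
  then have N: "N \<noteq> 0"
    unfolding fn_norm N_def by (simp add: at_x_eq_zero_iff)
  define S where "S = (\<Union>a\<in>{a. poly N a = 0}. Affine a ` {b. b ^ 2 = poly f a})"
  have fin_roots: "finite {a. poly N a = 0}"
    using N by (rule poly_roots_finite)
  have fin_fibre: "finite {b. b ^ 2 = poly f a}" for a
  proof -
    have "{b. b ^ 2 = poly f a} = {b. poly [:- poly f a, 0, 1:] b = 0}"
      by (auto simp: power2_eq_square)
    also have "finite \<dots>" by (rule poly_roots_finite) simp
    finally show ?thesis .
  qed
  have fin: "finite S"
    unfolding S_def using fin_roots fin_fibre by auto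
  have sum: "(\<Sum>P\<in>S. zero_mult U V P) = degree N"
  proof -
    have "(\<Sum>P\<in>S. zero_mult U V P) =
        (\<Sum>a | poly N a = 0. \<Sum>P\<in>Affine a ` {b. b ^ 2 = poly f a}. zero_mult U V P)"
      unfolding S_def using fin_roots fin_fibre by (intro sum.UNION_disjoint) auto
    also have "\<dots> = (\<Sum>a | poly N a = 0. \<Sum>b | b ^ 2 = poly f a. zero_mult U V (Affine a b))"
      by (intro sum.cong refl) (simp add: sum.reindex inj_on_def)
    also have "\<dots> = (\<Sum>a | poly N a = 0. Polynomial.order a N)"
      unfolding N_def using sum_zero_mult_fibre[OF nz] by simp
    finally show ?thesis
      using sum_order_eq_degree[OF N] by simp
  qed
  define M where "M = (\<Sum>P\<in>S. replicate_mset (zero_mult U V P) P)"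
  have count: "count M Q = (if Q \<in> S then zero_mult U V Q else 0)" for Q
    using fin by (simp add: M_def count_sum if_distrib sum.delta cong: if_cong)
  show ?thesis
  proof
    show "set_mset M \<subseteq> curve f - {Infinity}"
    proof
      fix Q assume "Q \<in># M"
      then have "Q \<in> S" using count by (metis not_in_iff)
      then show "Q \<in> curve f - {Infinity}" by (auto simp: S_def curve_def)
    qed
    show "size M = pole_order U V"
    proof -
      have "size M = (\<Sum>P\<in>S. zero_mult U V P)"
        unfolding M_def using fin by (induction S rule: finite_induct) simp_all
      then show ?thesis
        using sum degree_norm[of U V] by (simp add: N_def)
    qed
    fix a b
    assume on: "Affine a b \<in> curve f"
    have "count M (Affine a b) = zero_mult U V (Affine a b)"
    proof (cases "poly N a = 0")
      case True
      then show ?thesis using on by (auto simp: count S_def affine_on_curve)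
    next
      case False
      have "zero_mult U V (Affine a b) \<le> (\<Sum>b | b ^ 2 = poly f a. zero_mult U V (Affine a b))"
        using on fin_fibre by (intro member_le_sum) (auto simp: affine_on_curve)
      also have "\<dots> = 0"
        using False sum_zero_mult_fibre[OF nz, of a] by (simp add: N_def order_0I)
      finally show ?thesis
        using False by (auto simp: count S_def)
    qed
    then show "pt_ord (Affine a b) (fn U V) (int (count M (Affine a b)))"
      using zero_mult_ord[OF on nz] by simp
  qed
qed

lemma fn_common_factor: "fn (D * U) (D * V) = at_x.subst_poly D * fn U V"
  by (simp add: fn_def at_x.subst_mult algebra_simps)

text \<open>Over a point \<open>a\<close> that is not a branch point the values \<open>P(a) + Q(a) b\<close> and \<open>P(a) - Q(a) b\<close> both
  vanish; over a branch point \<open>P + Q y\<close> vanishes at least to the order \<open>2\<close> of \<open>x - a\<close>.\<close>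

lemma divisible_on_fibre_imp_roots:
  assumes "\<phi> \<noteq> 0" "\<And>b. Affine a b \<in> curve f \<Longrightarrow> \<exists>m\<ge>0. pt_ord (Affine a b) \<phi> m"
    and "\<phi> * at_x.subst_poly W = fn P Q" "W \<noteq> 0" "poly W a = 0"
  shows "poly P a = 0 \<and> poly Q a = 0"
proof -
  have W: "Polynomial.order a W \<ge> 1"
    using assms(4,5) by (simp add: order_root)
  have ord: "\<exists>m. pt_ord (Affine a b) (fn P Q) m \<and> m \<ge> (if b = 0 then 2 else 1)"
    if on: "Affine a b \<in> curve f" for b
  proof -
    obtain m where m: "m \<ge> 0" "pt_ord (Affine a b) \<phi> m"
      using assms(2)[OF on] by blast
    have "pt_ord (Affine a b) (fn P Q) (m + (if b = 0 then 2 else 1) * int (Polynomial.order a W))"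
      unfolding assms(3)[symmetric] by (intro pt_ord_mult[OF on] m poly_ord_affine[OF on assms(4)])
    then show ?thesis
      using m W by (intro exI conjI) auto
  qed
  obtain b where b: "b ^ 2 = poly f a"
    using nth_root_exists[of 2 "poly f a"] by auto
  have on: "Affine a b \<in> curve f" "Affine a (- b) \<in> curve f"
    using b by (simp_all add: affine_on_curve)
  interpret double_cover_point at_x.subst_poly "y_fn f" f a b
    by (rule affine_cover[OF on(1)])
  show ?thesis
  proof (cases "b = 0")
    case True
    then show ?thesis
      using ramified_order_ge_2_imp_root[OF True, of P Q] ord[OF on(1)]
      unfolding pt_ord_affine[OF on(1)] elem_affine[OF on(1)] by auto
  next
    case False
    interpret opp: double_cover_point at_x.subst_poly "y_fn f" f a "- b"
      by (rule affine_cover[OF on(2)])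
    have "val P Q = 0" "opp.val P Q = 0"
      using positive_order_imp_val_zero[of P Q] opp.positive_order_imp_val_zero[of P Q]
        ord[OF on(1)] ord[OF on(2)] False
      unfolding pt_ord_affine[OF on(1)] pt_ord_affine[OF on(2)] elem_affine[OF on(1)] by force+
    then have "poly P a + poly Q a * b = 0" "poly P a - poly Q a * b = 0"
      by (simp_all add: val_def opp.val_def)
    then have "2 * (poly Q a * b) = 0" "poly P a = poly Q a * b"
      by (simp_all only: mult_2) (simp_all add: algebra_simps)
    then show ?thesis
      using False by simp
  qed
qed

text \<open>Written with a denominator \<open>W\<close> in \<open>x\<close> alone, a function without poles in the affine plane has a
  numerator \<open>P + Q y\<close> from which each linear factor of \<open>W\<close> can be cancelled. Hence such functions are
  polynomials in \<open>x\<close> and \<open>y\<close>.\<close>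

lemma regular_imp_fn:
  assumes "\<phi> \<in> function_field f" "\<phi> \<noteq> 0"
    and reg: "\<And>a b. Affine a b \<in> curve f \<Longrightarrow> ord_at f (Affine a b) \<phi> \<ge> 0"
  obtains U V where "\<phi> = fn U V"
proof -
  have reg': "\<exists>m\<ge>0. pt_ord (Affine a b) \<phi> m" if "Affine a b \<in> curve f" for a b
    using pt_ord_ord_at[OF that assms(1,2)] reg[OF that] by blast
  have cancel: "\<exists>U V. \<phi> = fn U V" if "W \<noteq> 0" "\<phi> * at_x.subst_poly W = fn P Q" for W P Q
    using that
  proof (induction "degree W" arbitrary: W P Q rule: less_induct)
    case less
    show ?case
    proof (cases "degree W = 0")
      case True
      then obtain c where c: "W = [:c:]" "c \<noteq> 0"
        using less.prems by (auto elim: degree_eq_zeroE)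
      have "fn ([:inverse c:] * P) ([:inverse c:] * Q) = \<phi> * at_x.subst_poly ([:inverse c:] * W)"
        unfolding fn_common_factor less.prems(2)[symmetric] at_x.subst_mult by simp
      also have "[:inverse c:] * W = 1"
        using c by (simp add: one_pCons)
      finally show ?thesis
        by (metis at_x.subst_one mult.right_neutral)
    next
      case False
      then obtain a where a: "poly W a = 0"
        using alg_closed_imp_poly_has_root[of W] by auto
      have "poly P a = 0 \<and> poly Q a = 0"
        by (rule divisible_on_fibre_imp_roots[OF assms(2) reg' less.prems(2,1) a])
      then obtain P' Q' W' where P': "P = [:-a, 1:] * P'" "Q = [:-a, 1:] * Q'" "W = [:-a, 1:] * W'"
        using a by (auto simp: poly_eq_0_iff_dvd elim!: dvdE)
      have "W' \<noteq> 0" using P' less.prems by auto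
      then have "degree W = 1 + degree W'"
        unfolding P' by (subst degree_mult_eq) auto
      moreover have "\<phi> * at_x.subst_poly W' = fn P' Q'"
      proof -
        have "at_x.subst_poly [:-a, 1:] * (\<phi> * at_x.subst_poly W') = at_x.subst_poly [:-a, 1:] * fn P' Q'"
          using less.prems(2) unfolding P' fn_common_factor at_x.subst_mult by (simp add: mult_ac)
        then show ?thesis
          using at_x_eq_zero_iff[of "[:-a, 1:]"] by simp
      qed
      ultimately show ?thesis
        using less.hyps[of W' P' Q'] \<open>W' \<noteq> 0\<close> by simp
    qed
  qed
  obtain U V U' V' where 1: "\<phi> = fn U V / fn U' V'" "fn U' V' \<noteq> 0"
    using assms function_field_eq by auto
  \<comment> \<open>Multiplication by the conjugate makes the denominator a polynomial in \<open>x\<close>.\<close>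
  define N where "N = U' ^ 2 - V' ^ 2 * f"
  have nz: "fn U' (- V') \<noteq> 0"
    using 1(2) by (auto simp: fn_eq_zero)
  have N: "fn U' V' * fn U' (- V') = at_x.subst_poly N"
    unfolding N_def by (rule fn_norm)
  then have "N \<noteq> 0"
    using nz 1(2) at_x_eq_zero_iff by (metis mult_eq_0_iff)
  moreover have "\<phi> * at_x.subst_poly N = fn U V * fn U' (- V')"
    unfolding N[symmetric] using 1 by simp
  ultimately show ?thesis
    using cancel[of N] that unfolding fn_mult by blast
qed

end

section \<open>Divisor classes\<close>


lemma lookup_sum_frag_of:
  "Poly_Mapping.lookup (sum_list (map frag_of ps)) P = int (count (mset ps) P)"
  by (induction ps) (auto simp: lookup_add)

context odd_hyperelliptic
begin

lemma principal_iff: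
  "D \<in> principal_divisors f \<longleftrightarrow> Poly_Mapping.keys D \<subseteq> curve f \<and>
     (\<exists>\<phi>\<in>function_field f - {0}. \<forall>P\<in>curve f. pt_ord P \<phi> (Poly_Mapping.lookup D P))"
proof -
  have "Poly_Mapping.lookup D P = ord_at f P \<phi> \<longleftrightarrow> pt_ord P \<phi> (Poly_Mapping.lookup D P)"
    if "\<phi> \<in> function_field f - {0}" "P \<in> curve f" for \<phi> P
  proof
    have *: "pt_ord P \<phi> (ord_at f P \<phi>)"
      using that by (intro pt_ord_ord_at) auto
    show "pt_ord P \<phi> (Poly_Mapping.lookup D P)" if "Poly_Mapping.lookup D P = ord_at f P \<phi>"
      using * unfolding that .
    show "Poly_Mapping.lookup D P = ord_at f P \<phi>" if "pt_ord P \<phi> (Poly_Mapping.lookup D P)"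
      using ord_at_eq[OF \<open>P \<in> curve f\<close> that] by (rule sym)
  qed
  then show ?thesis
    unfolding principal_divisors_def mem_Collect_eq carrier_free_Abelian_group_iff
    by (intro conj_cong bex_cong ball_cong refl)
qed

lemma principal_diff:
  assumes "D \<in> principal_divisors f" "D' \<in> principal_divisors f"
  shows "D - D' \<in> principal_divisors f"
proof -
  obtain \<phi> \<psi> where \<phi>: "\<phi> \<in> function_field f - {0}" "\<forall>P\<in>curve f. pt_ord P \<phi> (Poly_Mapping.lookup D P)"
    and \<psi>: "\<psi> \<in> function_field f - {0}" "\<forall>P\<in>curve f. pt_ord P \<psi> (Poly_Mapping.lookup D' P)"
    using assms principal_iff by meson
  have "\<phi> / \<psi> \<in> function_field f - {0}"
    using \<phi>(1) \<psi>(1) function_field_mult function_field_inverse by (auto simp: divide_inverse)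
  moreover have "\<forall>P\<in>curve f. pt_ord P (\<phi> / \<psi>) (Poly_Mapping.lookup (D - D') P)"
    using \<phi>(2) \<psi>(2) pt_ord_divide by (simp add: lookup_minus)
  moreover have "Poly_Mapping.keys (D - D') \<subseteq> curve f"
    using assms keys_diff[of D D'] by (auto simp: principal_iff)
  ultimately show ?thesis
    using principal_iff by blast
qed

lemma principal_zero: "0 \<in> principal_divisors f"
proof -
  have "fn 1 0 \<noteq> (0 :: 'a poly fract alg_closure)"
    by (simp add: fn_eq_zero)
  then have "pt_ord P 1 0" if "P \<in> curve f" for P
    using pt_ord_divide[OF that pt_ord_ord_at[OF that fn_in_function_field] pt_ord_ord_at[OF that fn_in_function_field],
      of 1 0 1 0] by simp
  moreover have "1 \<in> function_field f - {0}"
    using fn_in_function_field[of 1 0] by (simp add: fn_poly at_x.subst_one)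
  ultimately show ?thesis
    unfolding principal_iff by (intro conjI bexI[of _ 1]) simp_all
qed

lemma principal_uminus: "D \<in> principal_divisors f \<Longrightarrow> - D \<in> principal_divisors f"
  using principal_diff[OF principal_zero] by simp

lemma principal_add:
  "D \<in> principal_divisors f \<Longrightarrow> D' \<in> principal_divisors f \<Longrightarrow> D + D' \<in> principal_divisors f"
  using principal_diff[of D "- D'"] principal_uminus by simp

lemma div_class_eq: "div_class f D = (\<lambda>h. h + D) ` principal_divisors f"
  by (auto simp: div_class_def r_coset_def div0_group_def free_Abelian_group_def)

lemma div_class_eq_iff: "div_class f D = div_class f D' \<longleftrightarrow> D - D' \<in> principal_divisors f"
proof
  assume "div_class f D = div_class f D'"
  moreover have "D \<in> div_class f D"
    unfolding div_class_eq using principal_zero by (intro image_eqI[of _ _ 0]) auto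
  ultimately show "D - D' \<in> principal_divisors f"
    unfolding div_class_eq by auto
next
  assume *: "D - D' \<in> principal_divisors f"
  have "h + D = (h + (D - D')) + D'" "h + D' = (h - (D - D')) + D" for h
    by (simp_all add: algebra_simps)
  then show "div_class f D = div_class f D'"
    unfolding div_class_eq using principal_add[OF _ *] principal_diff[OF _ *]
    by (intro equalityI image_subsetI) (metis imageI)+
qed

text \<open>The principal divisors form a group, so cosets are added through their representatives.\<close>

lemma div_class_mult: "div_class f D \<otimes>\<^bsub>Jac f\<^esub> div_class f D' = div_class f (D + D')"
proof -
  have "div_class f D \<otimes>\<^bsub>Jac f\<^esub> div_class f D' =
      {(h + D) + (h' + D') | h h'. h \<in> principal_divisors f \<and> h' \<in> principal_divisors f}"
    by (auto simp: Jac_def FactGroup_def set_mult_def div_class_eq div0_group_def free_Abelian_group_def)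
  also have "\<dots> = div_class f (D + D')"
  proof (intro equalityI subsetI)
    fix x assume "x \<in> {(h + D) + (h' + D') | h h'. h \<in> principal_divisors f \<and> h' \<in> principal_divisors f}"
    then obtain h h' where "x = (h + h') + (D + D')" "h \<in> principal_divisors f" "h' \<in> principal_divisors f"
      by (auto simp: algebra_simps)
    then show "x \<in> div_class f (D + D')"
      unfolding div_class_eq using principal_add by blast
  next
    fix x assume "x \<in> div_class f (D + D')"
    then obtain h where "x = (h + D) + (0 + D')" "h \<in> principal_divisors f"
      by (auto simp: div_class_eq algebra_simps)
    then show "x \<in> {(h + D) + (h' + D') | h h'. h \<in> principal_divisors f \<and> h' \<in> principal_divisors f}"
      using principal_zero by blast
  qed
  finally show ?thesis .
qed

lemma div_class_pow: "div_class f D [^]\<^bsub>Jac f\<^esub> j = div_class f (frag_cmul (int j) D)"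
proof (induction j)
  case 0
  have "div_class f 0 = principal_divisors f"
    by (simp add: div_class_eq)
  then show ?case
    by (simp add: nat_pow_def Jac_def FactGroup_def)
next
  case (Suc j)
  have "div_class f D [^]\<^bsub>Jac f\<^esub> Suc j = div_class f D [^]\<^bsub>Jac f\<^esub> j \<otimes>\<^bsub>Jac f\<^esub> div_class f D"
    by (simp add: nat_pow_def)
  then show ?case
    unfolding Suc div_class_mult by (simp add: frag_cmul_distrib add.commute)
qed

lemma Theta_Suc: "Theta f d \<subseteq> Theta f (Suc d)"
proof
  fix \<xi> assume "\<xi> \<in> Theta f d"
  then obtain ps where ps: "\<xi> = div_class f (sum_list (map frag_of ps) - frag_cmul (int d) (frag_of Infinity))"
    "length ps = d" "set ps \<subseteq> curve f"
    by (auto simp: Theta_def)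
  have eq: "sum_list (map frag_of (Infinity # ps)) - frag_cmul (int (Suc d)) (frag_of Infinity) =
     sum_list (map frag_of ps) - frag_cmul (int d) (frag_of (Infinity :: 'a point))"
    by (simp add: frag_cmul_distrib)
  then show "\<xi> \<in> Theta f (Suc d)"
    unfolding Theta_def ps(1) using ps(2,3) infinity_on_curve
    by (intro CollectI exI[of _ "Infinity # ps"] conjI arg_cong[OF eq[symmetric]]) auto
qed

lemma Theta_mono: "d \<le> e \<Longrightarrow> Theta f d \<subseteq> Theta f e"
  by (rule lift_Suc_mono_le[of "Theta f", OF Theta_Suc])

lemma Theta0_iff: "\<xi> \<in> Theta0 f e \<longleftrightarrow> \<xi> \<in> Theta f e \<and> (\<forall>d<e. \<xi> \<notin> Theta f d)"
proof (cases e)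
  case (Suc d)
  then show ?thesis
    using Theta_mono[of _ d] by (auto simp: less_Suc_eq_le)
qed simp

text \<open>The sets \<open>\<Theta>\<^sub>d\<close> increase with \<open>d\<close>, so the strata \<open>\<Theta>\<^sup>0\<^sub>d\<close> are disjoint and a class lies in the one where it
  appears for the first time.\<close>

lemma mult_profile_eq_Least:
  assumes "\<xi> [^]\<^bsub>Jac f\<^esub> j \<in> Theta f \<gamma>"
  shows "mult_profile f \<xi> j = (LEAST d. \<xi> [^]\<^bsub>Jac f\<^esub> j \<in> Theta f d)"
  unfolding mult_profile_def genus_f
proof (rule the_equality)
  show "(LEAST d. \<xi> [^]\<^bsub>Jac f\<^esub> j \<in> Theta f d) \<le> \<gamma> \<and>
      \<xi> [^]\<^bsub>Jac f\<^esub> j \<in> Theta0 f (LEAST d. \<xi> [^]\<^bsub>Jac f\<^esub> j \<in> Theta f d)"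
    using assms by (auto simp: Theta0_iff intro: Least_le LeastI dest: not_less_Least)
next
  fix e assume "e \<le> \<gamma> \<and> \<xi> [^]\<^bsub>Jac f\<^esub> j \<in> Theta0 f e"
  then show "e = (LEAST d. \<xi> [^]\<^bsub>Jac f\<^esub> j \<in> Theta f d)"
    by (intro Least_equality[symmetric]) (auto simp: Theta0_iff not_less[symmetric])
qed

lemma mult_profile_less_iff:
  assumes "\<xi> [^]\<^bsub>Jac f\<^esub> j \<in> Theta f \<gamma>" "\<gamma> > 0"
  shows "mult_profile f \<xi> j < \<gamma> \<longleftrightarrow> \<xi> [^]\<^bsub>Jac f\<^esub> j \<in> Theta f (\<gamma> - 1)"
proof
  assume "mult_profile f \<xi> j < \<gamma>"
  then have "mult_profile f \<xi> j \<le> \<gamma> - 1" by simp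
  moreover have "\<xi> [^]\<^bsub>Jac f\<^esub> j \<in> Theta f (mult_profile f \<xi> j)"
    unfolding mult_profile_eq_Least[OF assms(1)] using assms(1) by (rule LeastI)
  ultimately show "\<xi> [^]\<^bsub>Jac f\<^esub> j \<in> Theta f (\<gamma> - 1)"
    using Theta_mono by blast
next
  assume "\<xi> [^]\<^bsub>Jac f\<^esub> j \<in> Theta f (\<gamma> - 1)"
  then have "mult_profile f \<xi> j \<le> \<gamma> - 1"
    unfolding mult_profile_eq_Least[OF assms(1)] by (rule Least_le)
  then show "mult_profile f \<xi> j < \<gamma>" using assms(2) by simp
qed

text \<open>Near \<open>(0, -s)\<close> the function \<open>y\<close> is \<open>-A(x)\<close>. Modulo \<open>x\<^sup>n\<close> the series may be replaced by its truncation
  \<open>T\<close>: in \<open>(y + T) (y - T) = f - T\<^sup>2\<close> the right-hand side is divisible by \<open>x\<^sup>n\<close>, and \<open>y - T\<close> has the value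
  \<open>-2 s\<close> at the point, so \<open>y + T\<close> is divisible by \<open>x\<^sup>n\<close> locally and \<open>U + V y\<close> may be replaced by the
  polynomial \<open>U - V T\<close>.\<close>

lemma ord_ge_iff_series:
  fixes A :: "'a fps"
  assumes s: "s \<noteq> 0" "s ^ 2 = poly f 0" and A: "A ^ 2 = fps_of_poly f" "fps_nth A 0 = s"
    and m: "pt_ord (Affine 0 (- s)) (fn U V) m" and n: "n > 0"
  shows "m \<ge> int n \<longleftrightarrow> (\<forall>i<n. fps_nth (fps_of_poly U - fps_of_poly V * A) i = 0)"
proof -
  have on: "Affine 0 (- s) \<in> curve f"
    using s by (simp add: affine_on_curve)
  interpret double_cover_point at_x.subst_poly "y_fn f" f 0 "- s"
    by (rule affine_cover[OF on])
  note e = elem_affine[OF on]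
  have m': "has_ord (fn U V) m"
    using m unfolding pt_ord_affine[OF on] .
  define xn where "xn = at_x.subst_poly ([:0, 1 :: 'a:] ^ n)"
  have xn: "xn \<noteq> 0" "has_ord xn (int n)"
  proof -
    show "xn \<noteq> 0" by (simp add: xn_def at_x_eq_zero_iff)
    have "Polynomial.order 0 ([:- 0, 1 :: 'a:] ^ n) = n"
      by (rule order_power_n_n)
    then show "has_ord xn (int n)"
      using poly_has_ord[of "[:0, 1:] ^ n"] s(1) by (simp add: xn_def)
  qed
  have dvd_iff: "[:0, 1:] ^ n dvd p \<longleftrightarrow> (\<forall>i<n. Polynomial.coeff p i = 0)" for p :: "'a poly"
    using monom_1_dvd_iff'[of n p] by (simp add: monom_altdef)
  define T where "T = truncate_fps n A"
  define W where "W = U - V * T"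
  have AT: "fps_nth (B * A) i = fps_nth (B * fps_of_poly T) i" if "i < n" for B i
    using that by (auto simp: T_def fps_mult_nth intro!: sum.cong)
  have "[:0, 1:] ^ n dvd f - T ^ 2"
    unfolding dvd_iff
  proof (intro allI impI)
    fix i assume i: "i < n"
    have "Polynomial.coeff f i = fps_nth (A * A) i"
      using A(1) by (simp add: power2_eq_square)
    also have "\<dots> = fps_nth (fps_of_poly T * A) i"
      using AT[OF i, of A] by (simp add: mult.commute)
    also have "\<dots> = fps_nth (fps_of_poly T * fps_of_poly T) i"
      by (rule AT[OF i])
    finally show "Polynomial.coeff (f - T ^ 2) i = 0"
      by (simp add: power2_eq_square fps_of_poly_mult[symmetric])
  qed
  then obtain Q where Q: "f - T ^ 2 = [:0, 1:] ^ n * Q"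
    by (elim dvdE)
  have "poly T 0 = s"
    using n A(2) by (simp add: T_def poly_0_coeff_0)
  then have val': "val (- T) 1 \<noteq> 0"
    using s(1) by (simp add: val_def eq_neg_iff_add_eq_0 mult_2[symmetric])
  have inv: "inverse (fn (- T) 1) \<in> germs" and unit: "fn (- T) 1 \<noteq> 0"
    using inverse_elem_in_germs[OF val'] val_nonzero_imp_elem_nonzero[OF val'] unfolding e by auto
  have "fn T 1 * fn (- T) 1 = at_x.subst_poly (f - T ^ 2)"
    unfolding fn_mult fn_poly[symmetric] by (simp add: power2_eq_square)
  then have y_plus_T: "fn T 1 = xn * (at_x.subst_poly Q * inverse (fn (- T) 1))"
    using unit unfolding Q at_x.subst_mult xn_def[symmetric] by (simp add: field_simps)
  have W: "fn U V = at_x.subst_poly W + xn * (at_x.subst_poly V * at_x.subst_poly Q * inverse (fn (- T) 1))"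
  proof -
    have "fn U V = at_x.subst_poly W + at_x.subst_poly V * fn T 1"
    proof -
      have "at_x.subst_poly U = at_x.subst_poly W + at_x.subst_poly V * at_x.subst_poly T"
        by (simp add: W_def at_x.subst_add[symmetric] at_x.subst_mult[symmetric])
      then show ?thesis by (simp add: fn_def at_x.subst_one algebra_simps)
    qed
    then show ?thesis by (simp add: y_plus_T mult_ac)
  qed
  define r where "r = at_x.subst_poly V * at_x.subst_poly Q * inverse (fn (- T) 1)"
  have r: "r \<in> germs"
    unfolding r_def by (intro germs_mult E_in_germs inv)
  have coeff_W: "Polynomial.coeff W i = fps_nth (fps_of_poly U - fps_of_poly V * A) i" if "i < n" for i
    using AT[OF that, of "fps_of_poly V"] by (simp add: W_def fps_of_poly_mult[symmetric])
  have "m \<ge> int n \<longleftrightarrow> [:0, 1:] ^ n dvd W"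
  proof
    assume "[:0, 1:] ^ n dvd W"
    then obtain W' where "W = [:0, 1:] ^ n * W'" by (elim dvdE)
    then have "fn U V = xn * (at_x.subst_poly W' + r)"
      using W by (simp add: at_x.subst_mult xn_def r_def algebra_simps)
    then have "fn U V / xn \<in> germs"
      using xn(1) r by (auto intro: germs_add E_in_germs)
    moreover have "has_ord (fn U V / xn) (m - int n)"
      by (rule has_ord_divide[OF m' xn(2)])
    ultimately show "m \<ge> int n"
      using mem_imp_has_ord_nonneg by fastforce
  next
    assume mn: "m \<ge> int n"
    have "has_ord (fn U V / xn) (m - int n)"
      by (rule has_ord_divide[OF m' xn(2)])
    then have "fn U V / xn \<in> germs"
      using mn has_ord_nonneg_imp_mem by simp
    moreover have "at_x.subst_poly W / xn = fn U V / xn + - r"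
      using W xn(1) by (simp add: r_def field_simps)
    ultimately have mem: "at_x.subst_poly W / xn \<in> germs"
      using r by (metis germs_add germs_uminus)
    show "[:0, 1:] ^ n dvd W"
    proof (cases "W = 0")
      case False
      have "has_ord (at_x.subst_poly W) (int (Polynomial.order 0 W))"
        using poly_has_ord[OF False] s(1) by simp
      then have "has_ord (at_x.subst_poly W / xn) (int (Polynomial.order 0 W) - int n)"
        by (rule has_ord_divide[OF _ xn(2)])
      then have "int (Polynomial.order 0 W) - int n \<ge> 0"
        using mem by (rule mem_imp_has_ord_nonneg)
      then show ?thesis
        using order_divides[of 0 n W] by simp
    qed simp
  qed
  also have "\<dots> \<longleftrightarrow> (\<forall>i<n. fps_nth (fps_of_poly U - fps_of_poly V * A) i = 0)"
    unfolding dvd_iff using coeff_W by simp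
  finally show ?thesis .
qed

text \<open>The divisor of \<open>x\<close> is \<open>(0, s) + (0, -s) - 2\<infinity>\<close>: as \<open>s \<noteq> 0\<close>, the two points over \<open>0\<close> are not branch
  points.\<close>

lemma x_power_ord:
  assumes s: "s \<noteq> 0" "s ^ 2 = poly f 0" and P: "P \<in> curve f"
  shows "pt_ord P (at_x.subst_poly ([:0, 1:] ^ n))
    ((if P = Affine 0 s then int n else 0) + (if P = Affine 0 (- s) then int n else 0)
      + (if P = Infinity then - 2 * int n else 0))"
proof (cases P)
  case Infinity
  have "degree ([:0, 1:] ^ n :: 'a poly) = n"
    by (simp add: degree_power_eq)
  then show ?thesis
    using poly_ord_infinity[of "[:0, 1:] ^ n"] Infinity by simp
next
  case (Affine a b)
  have on: "Affine a b \<in> curve f" using P Affine by simp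
  have ab: "b ^ 2 = poly f a" using on by (simp add: affine_on_curve)
  have "pt_ord P (at_x.subst_poly ([:0, 1:] ^ n))
     ((if b = 0 then 2 else 1) * int (Polynomial.order a ([:0, 1:] ^ n)))"
    using poly_ord_affine[OF on, of "[:0, 1:] ^ n"] Affine by simp
  also have "(if b = 0 then 2 else 1) * int (Polynomial.order a ([:0, 1:] ^ n)) =
    (if P = Affine 0 s then int n else 0) + (if P = Affine 0 (- s) then int n else 0)
      + (if P = Infinity then - 2 * int n else 0)"
  proof (cases "a = 0")
    case True
    have ord: "Polynomial.order 0 ([:0, 1:] ^ n :: 'a poly) = n"
      using order_power_n_n[of "0 :: 'a" n] by simp
    have "b = s \<or> b = - s"
      using ab s(2) True by (metis power2_eq_iff)
    moreover have "s \<noteq> - s"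
      using s(1) by (simp add: eq_neg_iff_add_eq_0 mult_2[symmetric])
    ultimately show ?thesis
      using s(1) True Affine ord by auto
  next
    case False
    then have "Polynomial.order a ([:0, 1:] ^ n) = 0"
      by (intro order_0I) simp
    then show ?thesis using False Affine by simp
  qed
  finally show ?thesis .
qed

text \<open>Let \<open>p = (0, s)\<close> and \<open>p' = (0, -s)\<close>. Multiplication by \<open>x\<^sup>n\<close> turns a function with divisor
  \<open>E - d\<infinity> - n(p - \<infinity>)\<close>, where \<open>E\<close> is effective of degree \<open>d\<close>, into one with divisor
  \<open>E + n p' - (n + d)\<infinity>\<close>. The latter is some \<open>U + V y\<close> that vanishes to order \<open>n\<close> at \<open>p'\<close> and has a pole
  of order at most \<open>n + d\<close> at infinity; conversely the remaining zeros of such a function make up \<open>E\<close>.\<close>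

lemma multiple_in_Theta_iff:
  fixes A :: "'a fps"
  assumes s: "s \<noteq> 0" "s ^ 2 = poly f 0" and A: "A ^ 2 = fps_of_poly f" "fps_nth A 0 = s" and n: "n > 0"
  shows "div_class f (frag_cmul (int n) (frag_of (Affine 0 s) - frag_of Infinity)) \<in> Theta f d \<longleftrightarrow>
    (\<exists>U V. (U \<noteq> 0 \<or> V \<noteq> 0) \<and> pole_order U V \<le> n + d \<and>
      (\<forall>i<n. fps_nth (fps_of_poly U - fps_of_poly V * A) i = 0))" (is "?L \<longleftrightarrow> ?R")
proof -
  define D0 where "D0 = frag_cmul (int n) (frag_of (Affine 0 s) - frag_of Infinity)"
  define xn where "xn = at_x.subst_poly ([:0, 1 :: 'a:] ^ n)"
  define xord where "xord = (\<lambda>P. (if P = Affine 0 s then int n else 0) +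
    (if P = Affine 0 (- s) then int n else 0) + (if P = Infinity then - 2 * int n else 0))"
  have xn: "xn \<in> function_field f" "xn \<noteq> 0"
    using fn_in_function_field[of "[:0, 1:] ^ n" 0] by (simp_all add: xn_def fn_poly at_x_eq_zero_iff)
  have xnord: "pt_ord P xn (xord P)" if "P \<in> curve f" for P
    using x_power_ord[OF s that, of n] by (simp only: xn_def xord_def)
  have p: "Affine 0 s \<in> curve f" "Affine 0 (- s) \<in> curve f"
    using s by (simp_all add: affine_on_curve)
  have lookup_D0: "Poly_Mapping.lookup D0 P = int n * ((if P = Affine 0 s then 1 else 0) - (if P = Infinity then 1 else 0))" for P
    by (simp add: D0_def lookup_minus)
  have keys_D0: "Poly_Mapping.keys D0 \<subseteq> curve f"
    using p infinity_on_curve by (auto simp: in_keys_iff lookup_D0 split: if_splits)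
  define Dps where "Dps = (\<lambda>ps. sum_list (map frag_of ps) - frag_cmul (int d) (frag_of (Infinity :: 'a point)))"
  have lookup_Dps: "Poly_Mapping.lookup (Dps ps) P = int (count (mset ps) P) - (if P = Infinity then int d else 0)" for ps P
    by (simp add: Dps_def lookup_minus lookup_sum_frag_of)
  have keys_Dps: "Poly_Mapping.keys (Dps ps) \<subseteq> curve f" if "set ps \<subseteq> curve f" for ps
  proof
    fix P assume "P \<in> Poly_Mapping.keys (Dps ps)"
    then have "count (mset ps) P \<noteq> 0 \<or> P = Infinity"
      by (auto simp: in_keys_iff lookup_Dps split: if_splits)
    then show "P \<in> curve f"
      using that infinity_on_curve by (metis count_eq_zero_iff set_mset_mset subsetD)
  qed
  have L: "?L \<longleftrightarrow> (\<exists>ps. length ps = d \<and> set ps \<subseteq> curve f \<and> Dps ps - D0 \<in> principal_divisors f)"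
  proof -
    have "?L \<longleftrightarrow> (\<exists>ps. length ps = d \<and> set ps \<subseteq> curve f \<and> div_class f (Dps ps) = div_class f D0)"
      unfolding Theta_def mem_Collect_eq D0_def[symmetric] Dps_def by metis
    then show ?thesis by (simp only: div_class_eq_iff)
  qed
  show ?thesis
    unfolding L
  proof
    assume "\<exists>ps. length ps = d \<and> set ps \<subseteq> curve f \<and> Dps ps - D0 \<in> principal_divisors f"
    then obtain ps \<phi> where ps: "length ps = d" "set ps \<subseteq> curve f"
      and \<phi>: "\<phi> \<in> function_field f - {0}" "\<forall>P\<in>curve f. pt_ord P \<phi> (Poly_Mapping.lookup (Dps ps - D0) P)"
      unfolding principal_iff by blast
    define \<psi> where "\<psi> = \<phi> * xn"
    have \<psi>: "\<psi> \<in> function_field f" "\<psi> \<noteq> 0"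
      using \<phi>(1) xn function_field_mult by (auto simp: \<psi>_def)
    have \<psi>_ord: "pt_ord P \<psi> (int (count (mset ps) P) + (if P = Affine 0 (- s) then int n else 0)
        - (if P = Infinity then int (n + d) else 0))" if "P \<in> curve f" for P
    proof -
      have "pt_ord P \<psi> (Poly_Mapping.lookup (Dps ps - D0) P + xord P)"
        unfolding \<psi>_def using \<phi>(2) that xnord by (intro pt_ord_mult) auto
      also have "Poly_Mapping.lookup (Dps ps - D0) P + xord P =
        int (count (mset ps) P) + (if P = Affine 0 (- s) then int n else 0)
        - (if P = Infinity then int (n + d) else 0)"
        by (simp add: lookup_minus lookup_Dps lookup_D0 xord_def)
      finally show ?thesis .
    qed
    have "ord_at f (Affine a b) \<psi> \<ge> 0" if "Affine a b \<in> curve f" for a b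
      using ord_at_eq[OF that \<psi>_ord[OF that]] by simp
    then obtain U V where UV: "\<psi> = fn U V"
      using regular_imp_fn[OF \<psi>] by blast
    have nz: "U \<noteq> 0 \<or> V \<noteq> 0"
      using \<psi>(2) by (auto simp: UV fn_eq_zero)
    have "- int (pole_order U V) = int (count (mset ps) Infinity) - int (n + d)"
      using pt_ord_unique[OF infinity_on_curve fn_ord_infinity[OF nz]] \<psi>_ord[OF infinity_on_curve]
      unfolding UV by simp
    then have "pole_order U V \<le> n + d" by simp
    moreover have "\<forall>i<n. fps_nth (fps_of_poly U - fps_of_poly V * A) i = 0"
      using ord_ge_iff_series[OF s A \<psi>_ord[OF p(2), unfolded UV] n] by simp
    ultimately show ?R using nz by blast
  next
    assume ?R
    then obtain U V where nz: "U \<noteq> 0 \<or> V \<noteq> 0" and pole: "pole_order U V \<le> n + d"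
      and series: "\<forall>i<n. fps_nth (fps_of_poly U - fps_of_poly V * A) i = 0"
      by blast
    obtain M where M: "set_mset M \<subseteq> curve f - {Infinity}" "size M = pole_order U V"
      "\<And>a b. Affine a b \<in> curve f \<Longrightarrow> pt_ord (Affine a b) (fn U V) (int (count M (Affine a b)))"
      using zero_multiset[OF nz] by blast
    have "int n \<le> int (count M (Affine 0 (- s)))"
      using ord_ge_iff_series[OF s A M(3)[OF p(2)] n] series by blast
    then have sub: "replicate_mset n (Affine 0 (- s)) \<subseteq># M"
      by (simp add: count_le_replicate_mset_subset_eq)
    then have nM: "n \<le> pole_order U V"
      using size_mset_mono M(2) by fastforce
    \<comment> \<open>A pole of order less than \<open>n + d\<close> leaves fewer than \<open>d\<close> zeros; the point at infinity fills up.\<close>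
    define E where "E = (M - replicate_mset n (Affine 0 (- s))) + replicate_mset (n + d - pole_order U V) Infinity"
    obtain ps where ps: "mset ps = E" using ex_mset by blast
    have count_E: "int (count E P) = int (count M P) - (if P = Affine 0 (- s) then int n else 0)
        + (if P = Infinity then int (n + d) - int (pole_order U V) else 0)" for P
      using \<open>int n \<le> int (count M (Affine 0 (- s)))\<close> pole by (auto simp: E_def of_nat_diff)
    have "length ps = size E" using ps by (metis size_mset)
    also have "\<dots> = d"
      unfolding E_def size_union size_Diff_submset[OF sub] M(2) using nM pole by simp
    finally have "length ps = d" .
    moreover have ps_on: "set ps \<subseteq> curve f"
    proof -
      have "set ps = set_mset E" using ps by (metis set_mset_mset)
      then show ?thesis
        using M(1) infinity_on_curve in_diffD
        by (fastforce simp: E_def split: if_splits)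
    qed
    moreover have "Dps ps - D0 \<in> principal_divisors f"
      unfolding principal_iff
    proof (intro conjI bexI ballI)
      show "Poly_Mapping.keys (Dps ps - D0) \<subseteq> curve f"
        using keys_diff[of "Dps ps" D0] keys_D0 keys_Dps[OF ps_on] by blast
      show "fn U V / xn \<in> function_field f - {0}"
        using xn fn_in_function_field nz function_field_mult function_field_inverse
        by (auto simp: divide_inverse fn_eq_zero)
      fix P assume P: "P \<in> curve f"
      have M_inf: "count M Infinity = 0"
        using M(1) by (meson Diff_iff count_eq_zero_iff insertI1 subsetD)
      have "pt_ord P (fn U V) (int (count M P) - (if P = Infinity then int (pole_order U V) else 0))"
        using M(3) P fn_ord_infinity[OF nz] M_inf by (cases P) simp_all
      then have "pt_ord P (fn U V / xn)
          (int (count M P) - (if P = Infinity then int (pole_order U V) else 0) - xord P)"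
        by (rule pt_ord_divide[OF P _ xnord[OF P]])
      also have "int (count M P) - (if P = Infinity then int (pole_order U V) else 0) - xord P =
          Poly_Mapping.lookup (Dps ps - D0) P"
        by (simp add: lookup_minus lookup_Dps lookup_D0 xord_def ps count_E)
      finally show "pt_ord P (fn U V / xn) (Poly_Mapping.lookup (Dps ps - D0) P)" .
    qed
    ultimately show "\<exists>ps. length ps = d \<and> set ps \<subseteq> curve f \<and> Dps ps - D0 \<in> principal_divisors f"
      by blast
  qed
qed

end

section \<open>Hankel determinants\<close>


lemma det_mat_eq_0_iff:
  fixes g :: "nat \<Rightarrow> nat \<Rightarrow> 'a::field"
  shows "det (mat c c (\<lambda>(i, j). g i j)) = 0 \<longleftrightarrow>
    (\<exists>v. (\<exists>j<c. v j \<noteq> 0) \<and> (\<forall>i<c. (\<Sum>j<c. g i j * v j) = 0))"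
proof -
  define M where "M = mat c c (\<lambda>(i, j). g i j)"
  have M: "M \<in> carrier_mat c c" by (simp add: M_def)
  have prod: "(M *\<^sub>v w) $ i = (\<Sum>j<c. g i j * w $ j)" if "i < c" "w \<in> carrier_vec c" for i w
    using that by (auto simp: M_def scalar_prod_def lessThan_atLeast0 intro!: sum.cong)
  have "(\<exists>w. w \<in> carrier_vec c \<and> w \<noteq> 0\<^sub>v c \<and> M *\<^sub>v w = 0\<^sub>v c) \<longleftrightarrow>
    (\<exists>v. (\<exists>j<c. v j \<noteq> 0) \<and> (\<forall>i<c. (\<Sum>j<c. g i j * v j) = 0))" (is "?L \<longleftrightarrow> ?R")
  proof
    assume ?L
    then obtain w where w: "w \<in> carrier_vec c" "w \<noteq> 0\<^sub>v c" "M *\<^sub>v w = 0\<^sub>v c" by blast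
    have "\<exists>j<c. w $ j \<noteq> 0"
    proof (rule ccontr)
      assume "\<not> ?thesis"
      then have "w = 0\<^sub>v c" using w(1) by (intro eq_vecI) auto
      then show False using w(2) by simp
    qed
    moreover have "\<forall>i<c. (\<Sum>j<c. g i j * w $ j) = 0"
      using prod[OF _ w(1)] w(3) by simp
    ultimately show ?R by (intro exI[of _ "\<lambda>j. w $ j"]) simp
  next
    assume ?R
    then obtain v where v: "\<exists>j<c. v j \<noteq> 0" "\<forall>i<c. (\<Sum>j<c. g i j * v j) = 0" by blast
    define w where "w = vec c v"
    have w: "w \<in> carrier_vec c" by (simp add: w_def)
    obtain j where j: "j < c" "v j \<noteq> 0"
      using v(1) by blast
    have "w \<noteq> 0\<^sub>v c"
    proof
      assume "w = 0\<^sub>v c"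
      then have "w $ j = 0" using j(1) by simp
      then show False using j by (simp add: w_def)
    qed
    moreover have "M *\<^sub>v w = 0\<^sub>v c"
    proof (rule eq_vecI)
      fix i assume "i < dim_vec (0\<^sub>v c :: 'a vec)"
      then show "(M *\<^sub>v w) $ i = 0\<^sub>v c $ i"
        using prod[OF _ w] v(2) by (simp add: w_def)
    qed (simp add: M_def)
    ultimately show ?L using w by blast
  qed
  then show ?thesis
    using det_0_iff_vec_prod_zero[OF M] by (simp add: M_def)
qed

text \<open>Fewer equations than unknowns: pad the coefficient matrix with zero rows.\<close>

lemma underdetermined_system:
  fixes g :: "nat \<Rightarrow> nat \<Rightarrow> 'a::field"
  assumes "e < c"
  shows "\<exists>v. (\<exists>j<c. v j \<noteq> 0) \<and> (\<forall>i<e. (\<Sum>j<c. g i j * v j) = 0)"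
proof -
  define G where "G = (\<lambda>i j. if i < e then g i j else 0)"
  have "det (mat c c (\<lambda>(i, j). G j i)) = 0"
    unfolding det_mat_eq_0_iff
    by (intro exI[of _ "\<lambda>j. if j = e then 1 else 0"])
      (use assms in \<open>auto simp: G_def intro!: sum.neutral\<close>)
  moreover have "mat c c (\<lambda>(i, j). G j i) = transpose_mat (mat c c (\<lambda>(i, j). G i j))"
    by (intro eq_matI) auto
  ultimately have "det (mat c c (\<lambda>(i, j). G i j)) = 0"
    using det_transpose[of "mat c c (\<lambda>(i, j). G i j)" c] by simp
  then obtain v where v: "\<exists>j<c. v j \<noteq> 0" "\<forall>i<c. (\<Sum>j<c. G i j * v j) = 0"
    unfolding det_mat_eq_0_iff by blast
  have "(\<Sum>j<c. g i j * v j) = 0" if "i < e" for i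
    using v(2)[rule_format, of i] that assms by (simp add: G_def)
  then show ?thesis using v(1) by blast
qed

lemma coeff_sum_monom:
  "Polynomial.coeff (\<Sum>j<c. Polynomial.monom (w j) j) k = (if k < c then w k else 0)"
  by (simp add: coeff_sum if_distrib sum.delta cong: if_cong)

text \<open>Multiplication by \<open>A\<close> has a Toeplitz matrix; listing the coefficients of \<open>V\<close> from the top down turns
  it into a Hankel matrix.\<close>

lemma coeff_mult_eq_hankel_sum:
  fixes A :: "'a::comm_ring_1 fps" and V :: "'a poly"
  assumes "degree V < c" "c \<le> l"
  shows "fps_nth (fps_of_poly V * A) (l + i) =
    (\<Sum>j<c. fps_nth A (l + 1 - c + i + j) * Polynomial.coeff V (c - 1 - j))"
proof -
  have "fps_nth (fps_of_poly V * A) (l + i) =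
      (\<Sum>j=0..l + i. Polynomial.coeff V j * fps_nth A (l + i - j))"
    by (simp add: fps_mult_nth)
  also have "\<dots> = (\<Sum>j<c. Polynomial.coeff V j * fps_nth A (l + i - j))"
    using assms by (intro sum.mono_neutral_right ballI) (auto simp: coeff_eq_0)
  also have "\<dots> = (\<Sum>j<c. Polynomial.coeff V (c - Suc j) * fps_nth A (l + i - (c - Suc j)))"
    by (rule sum.nat_diff_reindex[symmetric])
  also have "\<dots> = (\<Sum>j<c. fps_nth A (l + 1 - c + i + j) * Polynomial.coeff V (c - 1 - j))"
  proof (intro sum.cong refl)
    fix j assume "j \<in> {..<c}"
    then have "l + i - (c - Suc j) = l + 1 - c + i + j"
      using assms(2) by simp
    then show "Polynomial.coeff V (c - Suc j) * fps_nth A (l + i - (c - Suc j)) =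
        fps_nth A (l + 1 - c + i + j) * Polynomial.coeff V (c - 1 - j)"
      by (simp add: mult.commute)
  qed
  finally show ?thesis .
qed

lemma gap_iff_hankel_kernel:
  fixes A :: "'a::field fps"
  assumes "c \<le> l"
  shows "(\<exists>V. V \<noteq> 0 \<and> degree V < c \<and> (\<forall>i<e. fps_nth (fps_of_poly V * A) (l + i) = 0)) \<longleftrightarrow>
    (\<exists>v. (\<exists>j<c. v j \<noteq> 0) \<and> (\<forall>i<e. (\<Sum>j<c. fps_nth A (l + 1 - c + i + j) * v j) = 0))" (is "?L \<longleftrightarrow> ?R")
proof
  assume ?L
  then obtain V where V: "V \<noteq> 0" "degree V < c" "\<forall>i<e. fps_nth (fps_of_poly V * A) (l + i) = 0"
    by blast
  have "\<exists>j<c. Polynomial.coeff V (c - 1 - j) \<noteq> 0"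
    using V by (intro exI[of _ "c - 1 - degree V"]) auto
  then show ?R
    using V(3) unfolding coeff_mult_eq_hankel_sum[OF V(2) assms]
    by (intro exI[of _ "\<lambda>j. Polynomial.coeff V (c - 1 - j)"]) simp
next
  assume ?R
  then obtain v j where v: "j < c" "v j \<noteq> 0" "\<forall>i<e. (\<Sum>j<c. fps_nth A (l + 1 - c + i + j) * v j) = 0"
    by blast
  define V where "V = (\<Sum>k<c. Polynomial.monom (v (c - 1 - k)) k)"
  have coeff: "Polynomial.coeff V k = (if k < c then v (c - 1 - k) else 0)" for k
    unfolding V_def by (rule coeff_sum_monom)
  have deg: "degree V < c"
  proof -
    have "degree V \<le> c - 1" by (rule degree_le) (auto simp: coeff)
    then show ?thesis using v(1) by simp
  qed
  have "Polynomial.coeff V (c - 1 - j) \<noteq> 0"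
    using v(1,2) by (simp add: coeff)
  then have "V \<noteq> 0" by auto
  moreover have "Polynomial.coeff V (c - 1 - j) = v j" if "j < c" for j
    using that by (simp add: coeff)
  then have "\<forall>i<e. fps_nth (fps_of_poly V * A) (l + i) = 0"
    unfolding coeff_mult_eq_hankel_sum[OF deg assms] using v(3) by simp
  ultimately show ?L using deg by blast
qed

context odd_hyperelliptic
begin

text \<open>The bound on the pole of \<open>U + V y\<close> says \<open>deg U < l\<close> and \<open>deg V < c\<close>. Given \<open>V\<close>, a suitable \<open>U\<close> is the
  part of \<open>V A\<close> of degree less than \<open>l\<close>, and it remains to require that the coefficients of \<open>V A\<close> from \<open>l\<close>
  to \<open>n - 1\<close> vanish. No solution has \<open>V = 0\<close>, because \<open>l \<le> n\<close>.\<close>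

lemma multiple_in_Theta_iff_gap:
  fixes A :: "'a fps"
  assumes s: "s \<noteq> 0" "s ^ 2 = poly f 0" and A: "A ^ 2 = fps_of_poly f" "fps_nth A 0 = s"
    and n: "n \<ge> \<gamma> + 2" and d: "d \<le> \<gamma>" "d \<ge> \<gamma> - 1"
  defines "l \<equiv> (n + d) div 2 + 1" and "c \<equiv> (n + d + 1 - 2 * \<gamma>) div 2"
  shows "div_class f (frag_cmul (int n) (frag_of (Affine 0 s) - frag_of Infinity)) \<in> Theta f d \<longleftrightarrow>
    (\<exists>V. V \<noteq> 0 \<and> degree V < c \<and> (\<forall>i<n - l. fps_nth (fps_of_poly V * A) (l + i) = 0))"
proof -
  have l: "l \<le> n" using n d by (simp add: l_def)
  have pole: "pole_order U V \<le> n + d \<longleftrightarrow> degree U < l \<and> (V \<noteq> 0 \<longrightarrow> degree V < c)" for U V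
  proof -
    have "2 * degree U \<le> n + d \<longleftrightarrow> degree U < l"
      unfolding l_def by linarith
    moreover have "2 * degree V + 2 * \<gamma> + 1 \<le> n + d \<longleftrightarrow> degree V < c"
    proof -
      have "2 * \<gamma> \<le> n + d + 1"
        using n d by linarith
      then obtain e where e: "n + d + 1 = 2 * \<gamma> + e"
        by (rule le_Suc_ex[THEN exE])
      have "2 * k + 2 \<le> e \<longleftrightarrow> k < e div 2" for k
        by presburger
      from this[of "degree V"] show ?thesis
        using e unfolding c_def by simp linarith
    qed
    ultimately show ?thesis by (auto simp: pole_order_def)
  qed
  have "(\<exists>U V. (U \<noteq> 0 \<or> V \<noteq> 0) \<and> pole_order U V \<le> n + d \<and>
      (\<forall>i<n. fps_nth (fps_of_poly U - fps_of_poly V * A) i = 0)) \<longleftrightarrow>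
    (\<exists>V. V \<noteq> 0 \<and> degree V < c \<and> (\<forall>i<n - l. fps_nth (fps_of_poly V * A) (l + i) = 0))" (is "?L \<longleftrightarrow> ?R")
  proof
    assume ?L
    then obtain U V where UV: "U \<noteq> 0 \<or> V \<noteq> 0" "degree U < l" "V \<noteq> 0 \<longrightarrow> degree V < c"
      "\<forall>i<n. fps_nth (fps_of_poly U - fps_of_poly V * A) i = 0"
      unfolding pole by blast
    have "V \<noteq> 0"
    proof
      assume V: "V = 0"
      then have "lead_coeff U = 0"
        using UV(2,4) l by simp
      then show False using UV(1) V by simp
    qed
    moreover have "fps_nth (fps_of_poly V * A) (l + i) = 0" if "i < n - l" for i
      using UV(4)[rule_format, of "l + i"] that UV(2) by (simp add: coeff_eq_0)
    ultimately show ?R using UV(3) by blast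
  next
    assume ?R
    then obtain V where V: "V \<noteq> 0" "degree V < c" "\<forall>i<n - l. fps_nth (fps_of_poly V * A) (l + i) = 0"
      by blast
    define U where "U = truncate_fps l (fps_of_poly V * A)"
    have "degree U < l"
      unfolding U_def by (rule degree_truncate_fps) (simp add: l_def)
    moreover have "fps_nth (fps_of_poly U - fps_of_poly V * A) i = 0" if "i < n" for i
      using V(3)[rule_format, of "i - l"] that by (cases "i < l") (simp_all add: U_def)
    ultimately show ?L
      unfolding pole using V by blast
  qed
  moreover have "n > 0" using n by simp
  ultimately show ?thesis
    using multiple_in_Theta_iff[OF s A] by blast
qed

text \<open>For \<open>d = \<gamma>\<close> there are \<open>c\<close> unknown coefficients of \<open>V\<close> and \<open>c - 1\<close> equations.\<close>

lemma multiple_in_Theta_genus: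
  fixes A :: "'a fps"
  assumes "s \<noteq> 0" "s ^ 2 = poly f 0" "A ^ 2 = fps_of_poly f" "fps_nth A 0 = s" "n \<ge> \<gamma> + 2"
  shows "div_class f (frag_cmul (int n) (frag_of (Affine 0 s) - frag_of Infinity)) \<in> Theta f \<gamma>"
proof -
  define l where "l = (n + \<gamma>) div 2 + 1"
  define c where "c = (n + \<gamma> + 1 - 2 * \<gamma>) div 2"
  obtain k where k: "n = \<gamma> + 2 + k"
    using assms(5) le_Suc_ex by blast
  have "(n + \<gamma>) div 2 = \<gamma> + 1 + k div 2" "n + \<gamma> + 1 - 2 * \<gamma> = 3 + k"
    unfolding k by simp_all
  then have "n - l < c" "c \<le> l"
    unfolding l_def c_def by (simp_all add: k)
  then show ?thesis
    using multiple_in_Theta_iff_gap[OF assms order.refl, folded l_def c_def]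
      gap_iff_hankel_kernel[of c l "n - l" A] underdetermined_system[of "n - l" c] by auto
qed

text \<open>For \<open>d = \<gamma> - 1\<close> there are as many equations as unknown coefficients of \<open>V\<close>.\<close>

lemma mult_profile_less_genus_iff:
  fixes A :: "'a fps"
  assumes "s \<noteq> 0" "s ^ 2 = poly f 0" "A ^ 2 = fps_of_poly f" "fps_nth A 0 = s" "n \<ge> \<gamma> + 2" "\<gamma> > 0"
    and l: "l = (n + \<gamma> - 1) div 2 + 1" and c: "c = (n - \<gamma>) div 2"
  shows "mult_profile f (div_class f (frag_of (Affine 0 s) - frag_of Infinity)) n < \<gamma> \<longleftrightarrow>
    det (hankel (fps_nth A) (l + 1 - c) c) = 0"
proof -
  obtain k where k: "n = \<gamma> + 2 + k"
    using assms(5) le_Suc_ex by blast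
  have lk: "l = \<gamma> + 1 + (k + 1) div 2" and ck: "c = 1 + k div 2"
    unfolding l c k using assms(6) by simp_all
  have "n - l = c" "c \<le> l"
    unfolding lk ck k by presburger+
  have l': "(n + (\<gamma> - 1)) div 2 + 1 = l" and c': "(n + (\<gamma> - 1) + 1 - 2 * \<gamma>) div 2 = c"
    unfolding l c using assms(6) by (simp_all add: k)
  have "mult_profile f (div_class f (frag_of (Affine 0 s) - frag_of Infinity)) n < \<gamma> \<longleftrightarrow>
    div_class f (frag_cmul (int n) (frag_of (Affine 0 s) - frag_of Infinity)) \<in> Theta f (\<gamma> - 1)"
    using mult_profile_less_iff[of "div_class f (frag_of (Affine 0 s) - frag_of Infinity)" n]
      multiple_in_Theta_genus[OF assms(1-5)] assms(6)
    unfolding div_class_pow by blast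
  also have "\<dots> \<longleftrightarrow> (\<exists>V. V \<noteq> 0 \<and> degree V < c \<and> (\<forall>i<c. fps_nth (fps_of_poly V * A) (l + i) = 0))"
    using multiple_in_Theta_iff_gap[OF assms(1-5), of "\<gamma> - 1"] unfolding l' c' \<open>n - l = c\<close> by simp
  also have "\<dots> \<longleftrightarrow> det (hankel (fps_nth A) (l + 1 - c) c) = 0"
    unfolding gap_iff_hankel_kernel[OF \<open>c \<le> l\<close>] hankel_def det_mat_eq_0_iff ..
  finally show ?thesis .
qed

end

theorem proposition4p15:
  fixes f :: "'a::{alg_closed_field, field_char_0} poly"
    and \<gamma> n :: nat
    and s :: 'a
    and A :: "'a fps"
  assumes "\<gamma> \<ge> 2"
    and "lead_coeff f = 1"
    and "coprime f (pderiv f)"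
    and "degree f = 2 * \<gamma> + 1"
    and "poly f 0 \<noteq> 0"
    and "s ^ 2 = poly f 0"
    and "A ^ 2 = fps_of_poly f"
    and "fps_nth A 0 = s"
    and "n \<ge> \<gamma> + 2"
  defines "\<epsilon> \<equiv> mult_profile f (div_class f (frag_of (Affine 0 s) - frag_of Infinity))"
  shows "(odd (n + \<gamma>) \<longrightarrow>
            (\<epsilon> n < \<gamma> \<longleftrightarrow> det (hankel (fps_nth A) (\<gamma> + 2) ((n - \<gamma> - 1) div 2)) = 0)) \<and>
         (even (n + \<gamma>) \<longrightarrow>
            (\<epsilon> n < \<gamma> \<longleftrightarrow> det (hankel (fps_nth A) (\<gamma> + 1) ((n - \<gamma>) div 2)) = 0))"
proof -
  interpret odd_hyperelliptic f \<gamma>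
    using assms by unfold_locales
  define l where "l = (n + \<gamma> - 1) div 2 + 1"
  define c where "c = (n - \<gamma>) div 2"
  have "s \<noteq> 0" using assms(5,6) by auto
  then have main: "\<epsilon> n < \<gamma> \<longleftrightarrow> det (hankel (fps_nth A) (l + 1 - c) c) = 0"
    unfolding \<epsilon>_def using assms by (intro mult_profile_less_genus_iff l_def c_def) auto
  obtain k where k: "n = \<gamma> + 2 + k"
    using assms(9) le_Suc_ex by blast
  have lk: "l = \<gamma> + 1 + (k + 1) div 2" and ck: "c = 1 + k div 2"
    unfolding l_def c_def k using assms(1) by simp_all
  show ?thesis
  proof (intro conjI impI)
    assume "odd (n + \<gamma>)"
    then have "odd k" unfolding k by presburger
    then have "l + 1 - c = \<gamma> + 2" "(n - \<gamma> - 1) div 2 = c"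
      unfolding lk ck k by presburger+
    then show "\<epsilon> n < \<gamma> \<longleftrightarrow> det (hankel (fps_nth A) (\<gamma> + 2) ((n - \<gamma> - 1) div 2)) = 0"
      using main by simp
  next
    assume "even (n + \<gamma>)"
    then have "even k" unfolding k by presburger
    then have "l + 1 - c = \<gamma> + 1"
      unfolding lk ck by presburger
    then show "\<epsilon> n < \<gamma> \<longleftrightarrow> det (hankel (fps_nth A) (\<gamma> + 1) ((n - \<gamma>) div 2)) = 0"
      using main by (simp add: c_def)
  qed
qed

end
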